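(* Let $n\geq 2$, let $\alpha=(\alpha_1,\dots,\alpha_n)\in\mathbb{R}^n\setminus\{0\}$, and let $\mathbb{D}_\alpha$ be the elementary Reinhardt domain defined below. Let $a=(a_1,\dots,a_n)\in\mathbb{D}_\alpha$ satisfy $\sigma(a)\geq 2$, where $\sigma(a):=\#\{j\in\{1,\dots,n\}:\alpha_j>0,\ a_j=0\}$. Let $\mu(a):=\min\{\alpha_j:\alpha_j>0,\ a_j=0\}$. Then $$\boldsymbol{s}_{\mathbb{D}_\alpha}(a,z)=|z^\alpha|^{1/\mu(a)}\quad\text{for all } z\in\mathbb{D}_\alpha,$$ where $|z^\alpha|:=|z_1|^{\alpha_1}\cdots|z_n|^{\alpha_n}$.
   Context: Let $\mathbb{C}^n(\alpha):=\{(z_1,\dots,z_n)\in\mathbb{C}^n:\ z_j\neq 0 \text{ for every } j \text{ with } \alpha_j<0\}$, and $\mathbb{D}_\alpha:=\{z\in\mathbb{C}^n(\alpha): |z_1|^{\alpha_1}\cdots|z_n|^{\alpha_n}<1\}$ (here $|z_j|^0:=1$). For a domain $G\subset\mathbb{C}^n$ and $a\in G$, let $\mathcal{S}_G(a)$ be the set of functions $u:G\to[0,1)$ such that $\log u$ is plurisubharmonic on $G$, $u(a)=0$, and $u$ is of class $\mathcal{C}^2$ in some neighborhood of $a$. The Sibony function of $G$ is $\boldsymbol{s}_G(a,z):=\sup\{\sqrt{u(z)}: u\in\mathcal{S}_G(a)\}$ for $a,z\in G$. *)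

theory Defs
  imports "HOL-Analysis.Analysis"
begin

definition elog :: "real \<Rightarrow> ereal" where
  "elog x = (if x \<le> 0 then -\<infinity> else ereal (ln x))"

definition usc_on :: "'a::topological_space set \<Rightarrow> ('a \<Rightarrow> ereal) \<Rightarrow> bool" where
  "usc_on S v \<longleftrightarrow> (\<forall>x\<in>S. \<forall>c. v x < c \<longrightarrow> (\<forall>\<^sub>F y in at x within S. v y < c))"

text \<open>Subharmonic functions (with values in [-infinity, infinity)) on an open set of the plane:
  upper semicontinuous and satisfying the sub-mean value inequality on every closed disc
  contained in the set. The mean value of the usc function over a circle is expressed as the
  infimum of the means of its continuous majorants (standard definition of the integral of a
  usc function, allowing the value -infinity).\<close>
definition subharmonic_on :: "complex set \<Rightarrow> (complex \<Rightarrow> ereal) \<Rightarrow> bool" where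
  "subharmonic_on \<Omega> w \<longleftrightarrow> usc_on \<Omega> w \<and> (\<forall>x\<in>\<Omega>. w x < \<infinity>) \<and>
     (\<forall>z0 r. r > 0 \<and> cball z0 r \<subseteq> \<Omega> \<longrightarrow>
        (\<forall>g :: complex \<Rightarrow> real. continuous_on (sphere z0 r) g \<and>
             (\<forall>\<zeta>\<in>sphere z0 r. w \<zeta> \<le> ereal (g \<zeta>)) \<longrightarrow>
             w z0 \<le> ereal ((1 / (2 * pi)) *
                      integral {0..2*pi} (\<lambda>t. g (z0 + complex_of_real r * cis t)))))"

definition psh_on :: "(complex^'n) set \<Rightarrow> (complex^'n \<Rightarrow> ereal) \<Rightarrow> bool" where
  "psh_on G v \<longleftrightarrow> usc_on G v \<and>
     (\<forall>p\<in>G. \<forall>b. subharmonic_on {w. p + (\<chi> j. w * b $ j) \<in> G}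
                                   (\<lambda>w. v (p + (\<chi> j. w * b $ j))))"

definition C2_on :: "'a::euclidean_space set \<Rightarrow> ('a \<Rightarrow> real) \<Rightarrow> bool" where
  "C2_on U u \<longleftrightarrow> (\<exists>D D2. (\<forall>x\<in>U. (u has_derivative D x) (at x)) \<and>
      (\<forall>h. \<forall>x\<in>U. ((\<lambda>y. D y h) has_derivative D2 x h) (at x)) \<and>
      (\<forall>h k. continuous_on U (\<lambda>x. D2 x h k)))"

definition sibony_class :: "(complex^'n) set \<Rightarrow> complex^'n \<Rightarrow> (complex^'n \<Rightarrow> real) set" where
  "sibony_class G a = {u. (\<forall>z\<in>G. 0 \<le> u z \<and> u z < 1) \<and> psh_on G (\<lambda>z. elog (u z)) \<and>
      u a = 0 \<and> (\<exists>U. open U \<and> a \<in> U \<and> U \<subseteq> G \<and> C2_on U u)}"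

definition sibony :: "(complex^'n) set \<Rightarrow> complex^'n \<Rightarrow> complex^'n \<Rightarrow> real" where
  "sibony G a z = Sup {sqrt (u z) | u. u \<in> sibony_class G a}"

text \<open>Power with the convention t^0 = 1 (note: in Isabelle 0 powr 0 = 0).\<close>
definition mpow :: "real \<Rightarrow> real \<Rightarrow> real" where
  "mpow t e = (if e = 0 then 1 else t powr e)"

definition zabs :: "real^'n \<Rightarrow> complex^'n \<Rightarrow> real" where
  "zabs \<alpha> z = (\<Prod>j\<in>UNIV. mpow (norm (z $ j)) (\<alpha> $ j))"

definition Dalpha :: "real^'n \<Rightarrow> (complex^'n) set" where
  "Dalpha \<alpha> = {z. (\<forall>j. \<alpha> $ j < 0 \<longrightarrow> z $ j \<noteq> 0) \<and> zabs \<alpha> z < 1}"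

end

theory Submission
  imports Defs "HOL-Complex_Analysis.Cauchy_Integral_Formula"
begin

text \<open>
  Upper bound. For a competitor \<open>u\<close> the function \<open>log u\<close> is psh and bounded above, hence constant
  along entire curves in the domain. The curves \<open>\<zeta> \<mapsto> (p\<^sub>j exp (\<zeta> L\<^sub>j))\<^sub>j\<close> with \<open>\<Sum>j. \<alpha>\<^sub>j L\<^sub>j = 0\<close> move any
  point off the zero set of \<open>z\<^sup>\<alpha>\<close> into the disc through a given point \<open>b\<close> in direction \<open>e\<^sub>k\<close>, and
  curves inside a hyperplane \<open>z\<^sub>k = 0\<close> with \<open>\<alpha>\<^sub>k > 0\<close> show that \<open>u\<close> vanishes on the whole zero set.
  Take \<open>\<alpha>\<^sub>k = \<mu>(a)\<close> and \<open>b\<close> close to \<open>a\<close> with \<open>b\<^sub>k = 0\<close> as its only zero: as \<open>u\<close> is nonnegative and of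
  class C2 near \<open>b\<close>, it is \<open>O(|\<xi>|\<^sup>2)\<close> on that disc, and a Schwarz lemma for \<open>log u\<close> gives
  \<open>u \<le> |z\<^sup>\<alpha>| powr (2 / \<mu>(a))\<close>.

  Lower bound. The right-hand side is itself a competitor: it is a product of powers
  \<open>|z\<^sub>j| powr (2 \<alpha>\<^sub>j / \<mu>(a))\<close>, whose exponents are at least 2 at the vanishing coordinates of \<open>a\<close>.
\<close>

section \<open>Subharmonic and semicontinuous functions\<close>

lemma holomorphic_circle_mean:
  fixes P :: "complex \<Rightarrow> complex"
  assumes "P holomorphic_on cball z0 r" "r > 0"
  shows "((\<lambda>t. P (z0 + complex_of_real r * cis t)) has_integral 2 * of_real pi * P z0) {0..2*pi}"
proof -
  have "((\<lambda>u. P u / (u - z0)) has_contour_integral 2 * of_real pi * \<i> * P z0) (circlepath z0 r)"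
    using Cauchy_integral_circlepath_simple[OF assms(1), of z0] assms(2) by simp
  hence "((\<lambda>t. P (z0 + r * cis t) / (r * cis t) * r * \<i> * cis t)
            has_integral 2 * of_real pi * \<i> * P z0) {0..2*pi}"
    unfolding circlepath_def by (subst (asm) has_contour_integral_part_circlepath_iff) auto
  hence "((\<lambda>t. \<i> * P (z0 + r * cis t)) has_integral 2 * of_real pi * \<i> * P z0) {0..2*pi}"
    by (rule has_integral_eq[rotated]) (use assms(2) in \<open>simp add: field_simps\<close>)
  from has_integral_mult_right[OF this, of "-\<i>"] show ?thesis
    by (simp add: algebra_simps)
qed

lemma Re_holomorphic_circle_mean:
  assumes "P holomorphic_on cball z0 r" "r > 0"
  shows "((\<lambda>t. Re (P (z0 + complex_of_real r * cis t))) has_integral 2 * pi * Re (P z0)) {0..2*pi}"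
  using has_integral_Re[OF holomorphic_circle_mean[OF assms]] by simp

text \<open>\<open>Re P\<close> is an admissible continuous majorant in the definition of
  \<open>subharmonic_on\<close>, and its circle mean is its value at the centre.\<close>

lemma subharmonic_on_le_Re_holomorphic:
  assumes "subharmonic_on \<Omega> w" "cball z0 r \<subseteq> \<Omega>" "r > 0" "P holomorphic_on cball z0 r"
    and "\<And>\<zeta>. \<zeta> \<in> sphere z0 r \<Longrightarrow> w \<zeta> \<le> ereal (Re (P \<zeta>))"
  shows "w z0 \<le> ereal (Re (P z0))"
proof -
  have "continuous_on (sphere z0 r) (\<lambda>\<zeta>. Re (P \<zeta>))"
    using holomorphic_on_imp_continuous_on[OF assms(4)]
    by (intro continuous_intros) (auto elim: continuous_on_subset)
  hence "w z0 \<le> ereal ((1 / (2 * pi)) * integral {0..2*pi} (\<lambda>t. Re (P (z0 + complex_of_real r * cis t))))"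
    using assms(1,2,3,5) unfolding subharmonic_on_def by blast
  thus ?thesis
    using integral_unique[OF Re_holomorphic_circle_mean[OF assms(4,3)]] by simp
qed

text \<open>Without a maximum the sets \<open>\<Phi> y < \<Phi> (Y x)\<close> would form a
  relatively open cover of \<open>K\<close>. In a finite subcover the largest bound \<open>m\<close>
  is itself a value of \<open>\<Phi>\<close> on \<open>K\<close>, hence strictly below one of the
  bounds.\<close>

lemma usc_on_attains_sup:
  fixes \<Phi> :: "'a::topological_space \<Rightarrow> ereal"
  assumes "compact K" "K \<noteq> {}" "usc_on K \<Phi>"
  shows "\<exists>x\<in>K. \<forall>y\<in>K. \<Phi> y \<le> \<Phi> x"
proof (rule ccontr)
  assume "\<not> ?thesis"
  hence "\<forall>x\<in>K. \<exists>y\<in>K. \<Phi> x < \<Phi> y" by (auto simp: not_le)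
  then obtain Y where Y: "\<And>x. x \<in> K \<Longrightarrow> Y x \<in> K \<and> \<Phi> x < \<Phi> (Y x)" by metis
  have "\<exists>U. open U \<and> x \<in> U \<and> (\<forall>y\<in>U \<inter> K. \<Phi> y < \<Phi> (Y x))" if "x \<in> K" for x
  proof -
    have "\<forall>\<^sub>F y in at x within K. \<Phi> y < \<Phi> (Y x)"
      using assms(3) Y that unfolding usc_on_def by blast
    thus ?thesis using Y[OF that] unfolding eventually_at_topological by (metis IntD1 IntD2)
  qed
  then obtain U where U: "\<And>x. x \<in> K \<Longrightarrow> open (U x) \<and> x \<in> U x \<and> (\<forall>y\<in>U x \<inter> K. \<Phi> y < \<Phi> (Y x))"
    by metis
  obtain F where F: "F \<subseteq> K" "finite F" "K \<subseteq> (\<Union>x\<in>F. U x)"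
    using compactE_image[OF assms(1), of K U] U by blast
  hence "F \<noteq> {}" using assms(2) by auto
  define m where "m = Max ((\<lambda>x. \<Phi> (Y x)) ` F)"
  have "m \<in> (\<lambda>x. \<Phi> (Y x)) ` F"
    unfolding m_def using F \<open>F \<noteq> {}\<close> by (intro Max_in) auto
  then obtain x where x: "x \<in> F" "m = \<Phi> (Y x)" by auto
  have "Y x \<in> K" using x F Y by blast
  then obtain x' where "x' \<in> F" "Y x \<in> U x'" using F by auto
  hence "\<Phi> (Y x) < \<Phi> (Y x')" using U[of x'] F \<open>Y x \<in> K\<close> by auto
  also have "\<dots> \<le> m" unfolding m_def using F \<open>x' \<in> F\<close> by auto
  finally show False using x by simp
qed

lemma usc_on_compose:
  assumes "usc_on G v" "continuous_on K F" "F ` K \<subseteq> G"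
  shows "usc_on K (\<lambda>x. v (F x))"
  unfolding usc_on_def
proof (intro ballI allI impI)
  fix x c assume x: "x \<in> K" "v (F x) < c"
  hence "\<forall>\<^sub>F y in at (F x) within G. v y < c"
    using assms unfolding usc_on_def by blast
  then obtain S where S: "open S" "F x \<in> S" "\<And>y. y \<in> S \<Longrightarrow> y \<in> G \<Longrightarrow> v y < c"
    using x unfolding eventually_at_topological by metis
  have "\<forall>\<^sub>F y in at x within K. F y \<in> S"
    using assms(2) x S by (auto simp: continuous_on tendsto_def)
  moreover have "\<forall>\<^sub>F y in at x within K. y \<in> K" by (simp add: eventually_at_filter)
  ultimately show "\<forall>\<^sub>F y in at x within K. v (F y) < c"
    by eventually_elim (use S assms(3) in auto)
qed

lemma usc_on_minus_continuous:
  assumes "usc_on K v" "continuous_on K q"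
  shows "usc_on K (\<lambda>x. v x - ereal (q x))"
  unfolding usc_on_def
proof (intro ballI allI impI)
  fix x c assume x: "x \<in> K" "v x - ereal (q x) < c"
  then obtain d where d: "v x - ereal (q x) < ereal d" "ereal d < c" using ereal_dense2 by blast
  hence "v x < ereal (d + q x)" by (cases "v x") auto
  then obtain e where e: "v x < ereal e" "e < d + q x" using ereal_dense2 by fastforce
  have "\<forall>\<^sub>F y in at x within K. v y < ereal e"
    using assms(1) x e unfolding usc_on_def by blast
  moreover have "\<forall>\<^sub>F y in at x within K. e - d < q y"
    using assms(2) x e by (intro order_tendstoD(1)[where y = "q x"]) (auto simp: continuous_on)
  ultimately show "\<forall>\<^sub>F y in at x within K. v y - ereal (q y) < c"
  proof eventually_elim
    case (elim y)
    have "v y - ereal (q y) < ereal d" using elim by (cases "v y") auto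
    thus ?case using d(2) by simp
  qed
qed


lemma usc_on_open_less:
  assumes "usc_on G v" "open G"
  shows "open {x \<in> G. v x < c}"
proof (rule topological_space_class.openI)
  fix x assume x: "x \<in> {x \<in> G. v x < c}"
  hence "\<forall>\<^sub>F y in at x within G. v y < c"
    using assms(1) unfolding usc_on_def by blast
  then obtain S where "open S" "x \<in> S" "\<And>y. y \<in> S \<Longrightarrow> y \<in> G \<Longrightarrow> v y < c"
    using x unfolding eventually_at_topological by (metis (no_types, lifting) mem_Collect_eq)
  thus "\<exists>T. open T \<and> x \<in> T \<and> T \<subseteq> {x \<in> G. v x < c}"
    using x assms(2) by (intro exI[of _ "S \<inter> G"]) auto
qed

section \<open>A maximum principle along holomorphic curves\<close>

lemma psh_on_lineD:
  assumes "psh_on G v" "p \<in> G"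
  shows "subharmonic_on {w. p + (\<chi> j. w * b $ j) \<in> G} (\<lambda>w. v (p + (\<chi> j. w * b $ j)))"
  using assms unfolding psh_on_def by blast

text \<open>Complex differentiability of the coordinates, with tolerance \<open>\<eta> / N\<close>
  each, since the Euclidean norm is at most the sum of the \<open>N\<close> coordinate norms. It
  bounds the distance between a curve and its tangent line.\<close>

lemma holomorphic_vec_expansion:
  fixes f :: "complex \<Rightarrow> complex^'n"
  assumes "\<And>j. (\<lambda>\<zeta>. f \<zeta> $ j) holomorphic_on W" "open W" "\<zeta>0 \<in> W" "\<eta> > 0"
  shows "\<forall>\<^sub>F t in nhds 0. norm (f (\<zeta>0 + t) - f \<zeta>0 - (\<chi> j. t * deriv (\<lambda>\<zeta>. f \<zeta> $ j) \<zeta>0)) \<le> \<eta> * norm t"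
proof -
  define N where "N = real CARD('n)"
  have N: "N > 0" by (simp add: N_def)
  have "\<forall>\<^sub>F t in nhds 0. norm (f (\<zeta>0 + t) $ j - f \<zeta>0 $ j - t * deriv (\<lambda>\<zeta>. f \<zeta> $ j) \<zeta>0) \<le> \<eta> / N * norm t" for j
  proof -
    have "((\<lambda>\<zeta>. f \<zeta> $ j) has_field_derivative deriv (\<lambda>\<zeta>. f \<zeta> $ j) \<zeta>0) (at \<zeta>0)"
      using assms holomorphic_derivI by blast
    hence "((\<lambda>\<zeta>. f \<zeta> $ j) has_derivative (\<lambda>t. t * deriv (\<lambda>\<zeta>. f \<zeta> $ j) \<zeta>0)) (at \<zeta>0)"
      by (simp add: has_field_derivative_def mult_commute_abs)
    then obtain d where d: "d > 0" "\<And>y. norm (y - \<zeta>0) < d \<Longrightarrow>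
       norm (f y $ j - f \<zeta>0 $ j - (y - \<zeta>0) * deriv (\<lambda>\<zeta>. f \<zeta> $ j) \<zeta>0) \<le> \<eta> / N * norm (y - \<zeta>0)"
      unfolding has_derivative_at_alt using divide_pos_pos[OF assms(4) N] by blast
    have "norm (f (\<zeta>0 + t) $ j - f \<zeta>0 $ j - t * deriv (\<lambda>\<zeta>. f \<zeta> $ j) \<zeta>0) \<le> \<eta> / N * norm t"
      if "dist t 0 < d" for t
      using d(2)[of "\<zeta>0 + t"] that by simp
    thus ?thesis unfolding eventually_nhds_metric using d(1) by blast
  qed
  hence "\<forall>\<^sub>F t in nhds 0. \<forall>j. norm (f (\<zeta>0 + t) $ j - f \<zeta>0 $ j - t * deriv (\<lambda>\<zeta>. f \<zeta> $ j) \<zeta>0) \<le> \<eta> / N * norm t"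
    by (rule eventually_all_finite)
  thus ?thesis
  proof eventually_elim
    case (elim t)
    let ?g = "f (\<zeta>0 + t) - f \<zeta>0 - (\<chi> j. t * deriv (\<lambda>\<zeta>. f \<zeta> $ j) \<zeta>0)"
    have "norm ?g \<le> (\<Sum>j\<in>UNIV. norm (?g $ j))"
      unfolding norm_vec_def by (rule L2_set_le_sum) simp
    also have "\<dots> \<le> (\<Sum>j\<in>(UNIV::'n set). \<eta> / N * norm t)"
      using elim by (intro sum_mono) simp
    also have "\<dots> = \<eta> * norm t" using N by (simp add: N_def)
    finally show ?case .
  qed
qed

text \<open>The cross term is the real part of an expression complex linear in \<open>g\<close>,
  hence harmonic when \<open>g\<close> depends holomorphically on a parameter and \<open>d\<close>
  is fixed.\<close>

lemma norm_vec_minus_squared: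
  fixes d g :: "complex^'n"
  shows "(norm (d - g))\<^sup>2 = (norm d)\<^sup>2 - 2 * Re (\<Sum>j\<in>UNIV. cnj (d $ j) * g $ j) + (norm g)\<^sup>2"
proof -
  have "d \<bullet> g = Re (\<Sum>j\<in>UNIV. cnj (d $ j) * g $ j)"
    by (simp add: inner_vec_def inner_complex_def)
  thus ?thesis
    by (simp add: power2_norm_eq_inner inner_diff_left inner_diff_right inner_commute)
qed

text \<open>Harmonic functions, given through local conjugates: for \<open>ln (norm \<zeta>)\<close>
  on an annulus only a local choice is possible, because its conjugate is multivalued.\<close>

definition locally_Re_holomorphic :: "complex set \<Rightarrow> (complex \<Rightarrow> real) \<Rightarrow> bool" where
  "locally_Re_holomorphic W h \<longleftrightarrow>
     (\<forall>\<zeta>\<in>W. \<exists>r>0. \<exists>q. q holomorphic_on ball \<zeta> r \<and> (\<forall>\<xi>\<in>ball \<zeta> r. h \<xi> = Re (q \<xi>)))"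

lemma locally_Re_holomorphic_imp_continuous_on:
  assumes "locally_Re_holomorphic W h"
  shows "continuous_on W h"
proof (rule continuous_at_imp_continuous_on, rule ballI)
  fix \<zeta> assume "\<zeta> \<in> W"
  then obtain r q where r: "r > 0" "q holomorphic_on ball \<zeta> r" "\<And>\<xi>. \<xi> \<in> ball \<zeta> r \<Longrightarrow> h \<xi> = Re (q \<xi>)"
    using assms unfolding locally_Re_holomorphic_def by blast
  have "continuous_on (ball \<zeta> r) (\<lambda>\<xi>. Re (q \<xi>))"
    using holomorphic_on_imp_continuous_on[OF r(2)] by (intro continuous_intros)
  hence "continuous_on (ball \<zeta> r) h" by (rule continuous_on_eq) (simp add: r(3))
  thus "isCont h \<zeta>" using r(1) by (simp add: continuous_on_eq_continuous_at)
qed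

text \<open>
  Plurisubharmonicity is only given along affine lines, so subharmonicity of \<^term>\<open>v \<circ> f\<close> is not
  available. The variables are doubled: \<^term>\<open>v (f \<zeta> + d) - h \<zeta> + \<epsilon> * (norm \<zeta>)\<^sup>2 - M * (norm d)\<^sup>2\<close>
  is maximised over \<^term>\<open>\<zeta>\<close> and a small displacement \<^term>\<open>d\<close>. Moving from a maximum point
  \<open>(\<zeta>0, d0)\<close> along the tangent line \<open>t \<mapsto> f \<zeta>0 + d0 + t f'(\<zeta>0)\<close> and
  compensating with \<open>\<zeta> = \<zeta>0 + t\<close>, the displacement is \<open>d0 - g t\<close> with \<open>g\<close> holomorphic and
  \<open>g t = o(t)\<close>; hence the penalty is harmonic up to \<open>o(t\<^sup>2)\<close> and cannot offset the \<open>\<epsilon> t\<^sup>2\<close> gained.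
\<close>

lemma psh_on_holomorphic_curve_le:
  fixes v :: "complex^'n \<Rightarrow> ereal" and f :: "complex \<Rightarrow> complex^'n"
  assumes G: "open G" and psh: "psh_on G v" and v0: "\<And>z. z \<in> G \<Longrightarrow> v z \<le> 0"
    and W: "open W" and hol: "\<And>j. (\<lambda>\<zeta>. f \<zeta> $ j) holomorphic_on W" and fW: "f ` W \<subseteq> G"
    and h: "locally_Re_holomorphic W h"
    and A: "compact A" "A \<subseteq> W"
    and bd: "\<And>\<zeta>. \<zeta> \<in> A - interior A \<Longrightarrow> v (f \<zeta>) \<le> ereal (h \<zeta>)"
    and \<zeta>1: "\<zeta>1 \<in> A"
  shows "v (f \<zeta>1) \<le> ereal (h \<zeta>1)"
proof (rule ccontr)
  assume "\<not> ?thesis"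
  moreover have "v (f \<zeta>1) \<le> 0" using v0 fW A \<zeta>1 by blast
  ultimately obtain V where V: "v (f \<zeta>1) = ereal V" "V > h \<zeta>1" by (cases "v (f \<zeta>1)") auto
  \<comment> \<open>Half of the supposed excess at \<open>\<zeta>1\<close>. The maximum found below
    is at least \<open>2 * e\<close>, while the perturbation
    \<open>\<epsilon> * (norm \<zeta>)\<^sup>2\<close> stays below \<open>e\<close> on
    \<open>A\<close>.\<close>
  define e where "e = (V - h \<zeta>1) / 2"
  have e: "e > 0" "V - h \<zeta>1 = 2 * e" using V by (auto simp: e_def)
  obtain B where B: "\<And>\<zeta>. \<zeta> \<in> A \<Longrightarrow> norm \<zeta> \<le> B" "B > 0"
    using compact_imp_bounded[OF A(1)] unfolding bounded_pos by blast
  define \<epsilon> where "\<epsilon> = e / (2 * B\<^sup>2)"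
  have \<epsilon>: "\<epsilon> > 0" using e B by (simp add: \<epsilon>_def)
  have \<epsilon>A: "\<epsilon> * (norm \<zeta>)\<^sup>2 < e" if "\<zeta> \<in> A" for \<zeta>
  proof -
    have "\<epsilon> * (norm \<zeta>)\<^sup>2 \<le> \<epsilon> * B\<^sup>2" using B(1)[OF that] \<epsilon> by (intro mult_left_mono power_mono) auto
    also have "\<dots> = e / 2" using B by (simp add: \<epsilon>_def)
    finally show ?thesis using e by linarith
  qed
  have hc: "continuous_on W h" by (rule locally_Re_holomorphic_imp_continuous_on[OF h])
  have fc: "continuous_on W f"
    using continuous_on_vec_lambda[of W "\<lambda>j \<zeta>. f \<zeta> $ j"] holomorphic_on_imp_continuous_on[OF hol]
    by simp
  have usc: "usc_on G v" using psh by (simp add: psh_on_def)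
  define f2 where "f2 = (\<lambda>\<zeta>. (\<zeta>, f \<zeta>))"
  have f2c: "continuous_on W f2" unfolding f2_def by (intro continuous_intros fc)
  define k where "k = (\<lambda>\<zeta>. h \<zeta> - \<epsilon> * (norm \<zeta>)\<^sup>2)"
  have kc: "continuous_on W k" unfolding k_def by (intro continuous_intros hc)
  \<comment> \<open>The boundary inequality, relaxed by \<open>e\<close>, is an open condition on
    pairs of parameter and target point; compactness of the graph over \<open>A - interior A\<close>
    extends it to all displacements of size at most \<open>\<rho>\<close>.\<close>
  define O1 where "O1 = {p \<in> W \<times> G. v (snd p) - ereal (k (fst p)) < ereal e}"
  have "usc_on (W \<times> G) (\<lambda>p. v (snd p) - ereal (k (fst p)))"
    by (intro usc_on_minus_continuous usc_on_compose[OF usc] continuous_intros continuous_on_compose2[OF kc]) auto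
  hence "open O1" unfolding O1_def using G W by (intro usc_on_open_less open_Times) auto
  moreover have "f2 ` (A - interior A) \<subseteq> O1"
  proof
    fix p assume "p \<in> f2 ` (A - interior A)"
    then obtain \<zeta> where \<zeta>: "\<zeta> \<in> A - interior A" "p = (\<zeta>, f \<zeta>)" by (auto simp: f2_def)
    have "v (f \<zeta>) - ereal (k \<zeta>) < ereal e"
      using bd[OF \<zeta>(1)] \<epsilon>A[of \<zeta>] \<zeta>(1) by (cases "v (f \<zeta>)") (auto simp: k_def)
    thus "p \<in> O1" using \<zeta> A fW by (auto simp: O1_def)
  qed
  moreover have "compact (f2 ` (A - interior A))"
    using A f2c by (intro compact_continuous_image compact_diff) (auto elim: continuous_on_subset)
  ultimately obtain \<rho>1 where \<rho>1: "\<rho>1 > 0" "(\<Union>p\<in>f2 ` (A - interior A). ball p \<rho>1) \<subseteq> O1"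
    using compact_subset_open_imp_ball_epsilon_subset by metis
  have "compact (f ` A)" using A fc by (intro compact_continuous_image) (auto elim: continuous_on_subset)
  then obtain \<rho>2 where \<rho>2: "\<rho>2 > 0" "(\<Union>p\<in>f ` A. ball p \<rho>2) \<subseteq> G"
    using compact_subset_open_imp_ball_epsilon_subset[of "f ` A" G] G fW A by blast
  define \<rho> where "\<rho> = min \<rho>1 \<rho>2 / 2"
  have \<rho>: "\<rho> > 0" "\<rho> < \<rho>1" "\<rho> < \<rho>2" using \<rho>1 \<rho>2 by (auto simp: \<rho>_def)
  have inG: "f \<zeta> + d \<in> G" if "\<zeta> \<in> A" "norm d \<le> \<rho>" for \<zeta> d
    using that \<rho> by (intro subsetD[OF \<rho>2(2)] UN_I[of "f \<zeta>"]) (auto simp: dist_norm)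
  have bd': "v (f \<zeta> + d) - ereal (k \<zeta>) < ereal e" if "\<zeta> \<in> A - interior A" "norm d \<le> \<rho>" for \<zeta> d
  proof -
    have "(\<zeta>, f \<zeta> + d) \<in> O1" using that \<rho>
      by (intro subsetD[OF \<rho>1(2)] UN_I[of "f2 \<zeta>"]) (auto simp: dist_norm f2_def norm_Pair)
    thus ?thesis by (simp add: O1_def)
  qed
  have "compact (h ` A)" using A hc by (intro compact_continuous_image) (auto elim: continuous_on_subset)
  then obtain H where H: "\<And>\<zeta>. \<zeta> \<in> A \<Longrightarrow> \<bar>h \<zeta>\<bar> \<le> H" "H > 0"
    unfolding compact_eq_bounded_closed bounded_pos by auto
  \<comment> \<open>With this weight the penalty on \<open>norm d = \<rho>\<close> equals
    \<open>H\<close>, which absorbs \<open>- h \<zeta>\<close> and so keeps the maximum away from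
    the boundary of the displacement ball.\<close>
  define M where "M = H / \<rho>\<^sup>2"
  have M: "M > 0" "M * \<rho>\<^sup>2 = H" using H \<rho> by (auto simp: M_def)
  define q where "q = (\<lambda>p::complex \<times> (complex^'n). k (fst p) + M * (norm (snd p))\<^sup>2)"
  define K where "K = A \<times> cball (0::complex^'n) \<rho>"
  define \<Phi> where "\<Phi> = (\<lambda>p. v (f (fst p) + snd p) - ereal (q p))"
  have "usc_on K \<Phi>"
    unfolding \<Phi>_def q_def
  proof (rule usc_on_minus_continuous)
    show "usc_on K (\<lambda>p. v (f (fst p) + snd p))"
      using A inG by (intro usc_on_compose[OF usc] continuous_intros continuous_on_compose2[OF fc])
        (auto simp: K_def)
    show "continuous_on K (\<lambda>p. k (fst p) + M * (norm (snd p))\<^sup>2)"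
      using A by (intro continuous_intros continuous_on_compose2[OF kc]) (auto simp: K_def)
  qed
  moreover have "compact K" "K \<noteq> {}"
    using A \<zeta>1 \<rho> by (auto simp: K_def compact_Times)
  ultimately obtain p0 where p0: "p0 \<in> K" "\<And>p. p \<in> K \<Longrightarrow> \<Phi> p \<le> \<Phi> p0"
    using usc_on_attains_sup by metis
  obtain \<zeta>0 d0 where p0_eq: "p0 = (\<zeta>0, d0)" by (cases p0)
  have \<zeta>0: "\<zeta>0 \<in> A" "norm d0 \<le> \<rho>" using p0 by (auto simp: p0_eq K_def)
  have "0 \<le> \<epsilon> * (norm \<zeta>1)\<^sup>2" using \<epsilon> by simp
  hence "2 * e \<le> V - (h \<zeta>1 - \<epsilon> * (norm \<zeta>1)\<^sup>2)" using e by linarith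
  hence "ereal (2 * e) \<le> \<Phi> (\<zeta>1, 0)" using V by (simp add: \<Phi>_def q_def k_def)
  also have "\<dots> \<le> \<Phi> p0" using p0(2)[of "(\<zeta>1, 0)"] \<zeta>1 \<rho> by (simp add: K_def)
  finally have m2: "ereal (2 * e) \<le> \<Phi> p0" .
  have v0': "v (f \<zeta>0 + d0) \<le> 0" using v0 inG \<zeta>0 by blast
  then obtain V0 where V0: "v (f \<zeta>0 + d0) = ereal V0" "V0 \<le> 0"
    using m2 by (cases "v (f \<zeta>0 + d0)") (auto simp: \<Phi>_def p0_eq)
  define m where "m = V0 - q (\<zeta>0, d0)"
  have m: "\<Phi> p0 = ereal m" "2 * e \<le> m" using m2 V0 by (auto simp: \<Phi>_def p0_eq m_def)
  have max: "v (f \<zeta> + d) \<le> ereal (m + q (\<zeta>, d))" if "\<zeta> \<in> A" "norm d \<le> \<rho>" for \<zeta> d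
    using p0(2)[of "(\<zeta>, d)"] that m(1) unfolding \<Phi>_def K_def
    by (cases "v (f \<zeta> + d)") auto
  have "\<zeta>0 \<in> interior A"
  proof (rule ccontr)
    assume "\<zeta>0 \<notin> interior A"
    hence "V0 - k \<zeta>0 < e" using bd'[of \<zeta>0 d0] \<zeta>0 V0 by simp
    moreover have "M * (norm d0)\<^sup>2 \<ge> 0" using M by simp
    ultimately show False using m e by (simp add: m_def q_def)
  qed
  have "norm d0 < \<rho>"
  proof (rule ccontr)
    assume "\<not> norm d0 < \<rho>"
    hence "norm d0 = \<rho>" using \<zeta>0 by simp
    hence "m \<le> - h \<zeta>0 + e - H" using V0 M \<epsilon>A[OF \<zeta>0(1)] by (simp add: m_def q_def k_def)
    thus False using H(1)[OF \<zeta>0(1)] m e by linarith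
  qed
  \<comment> \<open>Chosen so that the quadratic error of the penalty,
    \<open>M * (\<eta> * r)\<^sup>2\<close>, is half of the gain
    \<open>\<epsilon> * r\<^sup>2\<close>.\<close>
  define \<eta> where "\<eta> = sqrt (\<epsilon> / (2 * M))"
  have \<eta>: "\<eta> > 0" "M * \<eta>\<^sup>2 = \<epsilon> / 2" using \<epsilon> M by (auto simp: \<eta>_def)
  define b where "b = (\<chi> j. deriv (\<lambda>\<zeta>. f \<zeta> $ j) \<zeta>0)"
  define g where "g = (\<lambda>t. f (\<zeta>0 + t) - f \<zeta>0 - (\<chi> j. t * b $ j))"
  have "\<zeta>0 \<in> W" using \<zeta>0 A by blast
  have "\<forall>\<^sub>F t in nhds 0. norm (g t) \<le> \<eta> * norm t"
    using holomorphic_vec_expansion[OF hol W \<open>\<zeta>0 \<in> W\<close> \<eta>(1)] by (simp add: g_def b_def)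
  then obtain r1 where r1: "r1 > 0" "\<And>t. norm t < r1 \<Longrightarrow> norm (g t) \<le> \<eta> * norm t"
    unfolding eventually_nhds_metric by auto
  obtain r2 where r2: "r2 > 0" "ball \<zeta>0 r2 \<subseteq> A"
    using \<open>\<zeta>0 \<in> interior A\<close> mem_interior by blast
  obtain r3 Q where r3: "r3 > 0" "Q holomorphic_on ball \<zeta>0 r3" "\<And>\<xi>. \<xi> \<in> ball \<zeta>0 r3 \<Longrightarrow> h \<xi> = Re (Q \<xi>)"
    using h \<open>\<zeta>0 \<in> W\<close> unfolding locally_Re_holomorphic_def by blast
  \<comment> \<open>As \<open>norm (g t) \<le> \<eta> * norm t\<close>, radii up to
    \<open>r4\<close> keep \<open>d0 - g t\<close> in the ball of radius
    \<open>\<rho>\<close>.\<close>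
  define r4 where "r4 = (\<rho> - norm d0) / \<eta>"
  have r4: "r4 > 0" "\<eta> * r4 = \<rho> - norm d0" using \<open>norm d0 < \<rho>\<close> \<eta> by (auto simp: r4_def)
  define r where "r = Min {r1, r2, r3, r4} / 2"
  have "Min {r1, r2, r3, r4} > 0" using r1 r2 r3 r4 by simp
  hence r: "r > 0" "r < r1" "r < r2" "r < r3" "r < r4" by (auto simp: r_def min_def)
  have point: "f \<zeta>0 + d0 + (\<chi> j. t * b $ j) = f (\<zeta>0 + t) + (d0 - g t)" for t
    by (simp add: g_def)
  have gt: "norm (g t) \<le> \<eta> * r" "\<zeta>0 + t \<in> A" "norm (d0 - g t) \<le> \<rho>" if "norm t \<le> r" for t
  proof -
    have "norm (g t) \<le> \<eta> * norm t" using r1(2)[of t] r that by simp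
    also have "\<dots> \<le> \<eta> * r" using that \<eta> by simp
    finally show 1: "norm (g t) \<le> \<eta> * r" .
    show "\<zeta>0 + t \<in> A" using r2(2) r that by (intro subsetD[OF r2(2)]) (simp add: dist_norm)
    have "\<eta> * r \<le> \<eta> * r4" using r \<eta> by simp
    thus "norm (d0 - g t) \<le> \<rho>" using 1 r4 norm_triangle_ineq4[of d0 "g t"] by linarith
  qed
  \<comment> \<open>A holomorphic function whose real part majorises
    \<open>m + q (\<zeta>0 + t, d0 - g t)\<close> on \<open>norm t = r\<close>: there
    \<open>(norm t)\<^sup>2\<close> is the constant \<open>r\<^sup>2\<close>, and
    \<open>(norm (g t))\<^sup>2\<close> is replaced by its bound
    \<open>(\<eta> * r)\<^sup>2\<close>.\<close>
  define P where "P = (\<lambda>t. of_real m + Q (\<zeta>0 + t) - of_real \<epsilon> * (of_real ((norm \<zeta>0)\<^sup>2 + r\<^sup>2) + 2 * cnj \<zeta>0 * t)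
     + of_real M * (of_real ((norm d0)\<^sup>2 + (\<eta> * r)\<^sup>2) - 2 * (\<Sum>j\<in>UNIV. cnj (d0 $ j) * g t $ j)))"
  have "v (f \<zeta>0 + d0 + (\<chi> j. 0 * b $ j)) \<le> ereal (Re (P 0))"
  proof (rule subharmonic_on_le_Re_holomorphic[where w = "\<lambda>t. v (f \<zeta>0 + d0 + (\<chi> j. t * b $ j))" and r = r])
    show "subharmonic_on {t. f \<zeta>0 + d0 + (\<chi> j. t * b $ j) \<in> G} (\<lambda>t. v (f \<zeta>0 + d0 + (\<chi> j. t * b $ j)))"
      using psh inG \<zeta>0 by (intro psh_on_lineD) auto
    show "cball 0 r \<subseteq> {t. f \<zeta>0 + d0 + (\<chi> j. t * b $ j) \<in> G}"
      unfolding point using inG gt by auto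
    have g_hol: "(\<lambda>t. g t $ j) holomorphic_on cball 0 r" for j
      unfolding g_def using gt(2) A
      by (auto intro!: holomorphic_intros holomorphic_on_compose_gen[OF _ hol, unfolded o_def])
    have Q_hol: "(\<lambda>t. Q (\<zeta>0 + t)) holomorphic_on cball 0 r"
      using r by (auto intro!: holomorphic_intros holomorphic_on_compose_gen[OF _ r3(2), unfolded o_def] simp: dist_norm)
    show "P holomorphic_on cball 0 r"
      unfolding P_def by (intro holomorphic_intros g_hol Q_hol)
  next
    fix t :: complex assume "t \<in> sphere 0 r"
    hence t: "norm t = r" by simp
    have "v (f \<zeta>0 + d0 + (\<chi> j. t * b $ j)) \<le> ereal (m + q (\<zeta>0 + t, d0 - g t))"
      unfolding point using gt t by (intro max) auto
    also have "m + q (\<zeta>0 + t, d0 - g t) \<le> Re (P t)"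
    proof -
      have "(norm (\<zeta>0 + t))\<^sup>2 = (norm \<zeta>0)\<^sup>2 + r\<^sup>2 + Re (2 * cnj \<zeta>0 * t)"
        unfolding t[symmetric] cmod_power2 by (simp add: power2_eq_square algebra_simps)
      moreover have "h (\<zeta>0 + t) = Re (Q (\<zeta>0 + t))" using r3(3)[of "\<zeta>0 + t"] r t by (simp add: dist_norm)
      moreover have "M * (norm (d0 - g t))\<^sup>2 \<le> M * ((norm d0)\<^sup>2 + (\<eta> * r)\<^sup>2 - 2 * Re (\<Sum>j\<in>UNIV. cnj (d0 $ j) * g t $ j))"
        unfolding norm_vec_minus_squared using gt(1)[of t] t M
        by (intro mult_left_mono) (auto intro!: power_mono)
      ultimately show ?thesis unfolding q_def k_def P_def
        by (simp del: Re_sum)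
    qed
    finally show "v (f \<zeta>0 + d0 + (\<chi> j. t * b $ j)) \<le> ereal (Re (P t))" by simp
  qed (use r in auto)
  hence "V0 \<le> Re (P 0)" using V0 by (simp add: zero_vec_def[symmetric])
  moreover have "g 0 = 0" by (simp add: g_def vec_eq_iff)
  hence "Re (P 0) = m + h \<zeta>0 - \<epsilon> * ((norm \<zeta>0)\<^sup>2 + r\<^sup>2) + M * ((norm d0)\<^sup>2 + (\<eta> * r)\<^sup>2)"
    using r3 by (simp add: P_def)
  moreover have "M * (\<eta> * r)\<^sup>2 = \<epsilon> / 2 * r\<^sup>2"
    using \<eta>(2) by (simp add: power_mult_distrib mult.assoc[symmetric])
  ultimately have "\<epsilon> * r\<^sup>2 \<le> \<epsilon> / 2 * r\<^sup>2"
    unfolding m_def q_def k_def fst_conv snd_conv distrib_left by linarith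
  thus False using \<epsilon> r by simp
qed

section \<open>Liouville and Schwarz type lemmas\<close>

text \<open>On the disc of radius \<open>norm \<zeta>\<close> about \<open>\<zeta>\<close> the
  quotient \<open>\<xi> / \<zeta>\<close> has positive real part, so its principal logarithm is
  holomorphic there.\<close>

lemma locally_Re_holomorphic_ln_norm:
  assumes "0 \<notin> W"
  shows "locally_Re_holomorphic W (\<lambda>\<zeta>. \<kappa> * ln (norm \<zeta>) + c)"
  unfolding locally_Re_holomorphic_def
proof
  fix \<zeta> assume "\<zeta> \<in> W"
  hence \<zeta>: "\<zeta> \<noteq> 0" using assms by auto
  have Re_pos: "Re (\<xi> / \<zeta>) > 0" if "\<xi> \<in> ball \<zeta> (norm \<zeta>)" for \<xi>
  proof -
    have "norm (\<xi> / \<zeta> - 1) = norm (\<xi> - \<zeta>) / norm \<zeta>" using \<zeta> by (simp add: norm_divide[symmetric] diff_divide_distrib)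
    also have "\<dots> < 1" using that \<zeta> by (simp add: dist_norm norm_minus_commute)
    finally show ?thesis using abs_Re_le_cmod[of "\<xi> / \<zeta> - 1"] by simp
  qed
  have nonpos: "\<xi> / \<zeta> \<notin> \<real>\<^sub>\<le>\<^sub>0" if "\<xi> \<in> ball \<zeta> (norm \<zeta>)" for \<xi>
    using Re_pos[OF that] unfolding complex_nonpos_Reals_iff by linarith
  define q where "q = (\<lambda>\<xi>. of_real \<kappa> * (Ln (\<xi> / \<zeta>) + of_real (ln (norm \<zeta>))) + of_real c)"
  have "q holomorphic_on ball \<zeta> (norm \<zeta>)"
    unfolding q_def using nonpos \<zeta> by (intro holomorphic_intros) auto
  moreover have "\<kappa> * ln (norm \<xi>) + c = Re (q \<xi>)" if "\<xi> \<in> ball \<zeta> (norm \<zeta>)" for \<xi>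
  proof -
    have "\<xi> \<noteq> 0" using Re_pos[OF that] by auto
    thus ?thesis using \<zeta> by (simp add: q_def norm_divide ln_div)
  qed
  ultimately show "\<exists>r>0. \<exists>q. q holomorphic_on ball \<zeta> r \<and> (\<forall>\<xi>\<in>ball \<zeta> r. \<kappa> * ln (norm \<xi>) + c = Re (q \<xi>))"
    using \<zeta> by (intro exI[of _ "norm \<zeta>"]) auto
qed

text \<open>The maximum principle with a radial harmonic comparison function; both the Liouville and
  the Schwarz estimate reduce to suitable \<open>\<kappa>\<close> and \<open>c\<close>.\<close>

lemma psh_on_curve_annulus_le:
  fixes v :: "complex^'n \<Rightarrow> ereal" and f :: "complex \<Rightarrow> complex^'n"
  assumes G: "open G" "psh_on G v" "\<And>z. z \<in> G \<Longrightarrow> v z \<le> 0"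
    and W: "open W" "\<And>j. (\<lambda>\<zeta>. f \<zeta> $ j) holomorphic_on W" "f ` W \<subseteq> G"
    and \<delta>: "0 < \<delta>" "cball 0 R - ball 0 \<delta> \<subseteq> W"
    and inner: "\<And>\<zeta>. norm \<zeta> = \<delta> \<Longrightarrow> v (f \<zeta>) \<le> ereal (\<kappa> * ln \<delta> + c)"
    and outer: "\<And>\<zeta>. norm \<zeta> = R \<Longrightarrow> v (f \<zeta>) \<le> ereal (\<kappa> * ln R + c)"
    and \<zeta>: "\<delta> \<le> norm \<zeta>" "norm \<zeta> \<le> R"
  shows "v (f \<zeta>) \<le> ereal (\<kappa> * ln (norm \<zeta>) + c)"
proof (rule psh_on_holomorphic_curve_le[where W = "W - {0}" and A = "cball 0 R - ball 0 \<delta>" and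
      h = "\<lambda>\<zeta>. \<kappa> * ln (norm \<zeta>) + c", OF G])
  show "open (W - {0})" using W(1) by auto
  show "(\<lambda>\<zeta>. f \<zeta> $ j) holomorphic_on W - {0}" for j using W(2) holomorphic_on_subset by blast
  show "f ` (W - {0}) \<subseteq> G" using W(3) by auto
  show "locally_Re_holomorphic (W - {0}) (\<lambda>\<zeta>. \<kappa> * ln (norm \<zeta>) + c)"
    by (rule locally_Re_holomorphic_ln_norm) simp
  show "compact (cball (0::complex) R - ball 0 \<delta>)" by (intro compact_diff) auto
  show "cball 0 R - ball 0 \<delta> \<subseteq> W - {0}" using \<delta> by auto
  show "\<zeta> \<in> cball 0 R - ball 0 \<delta>" using \<zeta> by auto
next
  fix \<xi> :: complex
  assume \<xi>: "\<xi> \<in> (cball 0 R - ball 0 \<delta>) - interior (cball 0 R - ball 0 \<delta>)"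
  have "ball 0 R - cball (0::complex) \<delta> \<subseteq> interior (cball 0 R - ball 0 \<delta>)"
    by (intro interior_maximal) auto
  hence "norm \<xi> = \<delta> \<or> norm \<xi> = R" using \<xi> by force
  thus "v (f \<xi>) \<le> ereal (\<kappa> * ln (norm \<xi>) + c)" using inner outer by auto
qed

text \<open>Liouville's argument: if \<open>v (f 0) < c < v (f \<zeta>)\<close>, the function
  \<open>c + \<eta> * ln (norm \<xi> / \<delta>)\<close> majorises on a small circle by
  semicontinuity and on a large one because \<open>v \<le> 0\<close>, but for small
  \<open>\<eta>\<close> it lies below \<open>v (f \<zeta>)\<close> at
  \<open>\<zeta>\<close>.\<close>

lemma psh_on_entire_curve_le:
  fixes v :: "complex^'n \<Rightarrow> ereal" and f :: "complex \<Rightarrow> complex^'n"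
  assumes G: "open G" "psh_on G v" "\<And>z. z \<in> G \<Longrightarrow> v z \<le> 0"
    and hol: "\<And>j. (\<lambda>\<zeta>. f \<zeta> $ j) holomorphic_on UNIV" and fG: "range f \<subseteq> G"
  shows "v (f \<zeta>) \<le> v (f 0)"
proof (rule ccontr)
  assume "\<not> ?thesis"
  then obtain c where c: "v (f 0) < ereal c" "ereal c < v (f \<zeta>)" using ereal_dense2 by (auto simp: not_le)
  have "v (f \<zeta>) \<le> 0" using G(3) fG by auto
  with c obtain V where V: "v (f \<zeta>) = ereal V" "c < V" by (cases "v (f \<zeta>)") auto
  have \<zeta>: "\<zeta> \<noteq> 0" using c by auto
  have fc: "continuous_on UNIV f"
    using continuous_on_vec_lambda[of UNIV "\<lambda>j \<zeta>. f \<zeta> $ j"] holomorphic_on_imp_continuous_on[OF hol]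
    by simp
  have "usc_on UNIV (\<lambda>\<xi>. v (f \<xi>))"
    using G(2) fG by (intro usc_on_compose[OF _ fc]) (auto simp: psh_on_def)
  hence "open {\<xi> \<in> UNIV. v (f \<xi>) < ereal c}" by (rule usc_on_open_less) simp
  then obtain \<delta>0 where \<delta>0: "\<delta>0 > 0" "\<And>\<xi>. norm \<xi> < \<delta>0 \<Longrightarrow> v (f \<xi>) < ereal c"
    using c(1) unfolding open_contains_ball by (force simp: subset_iff)
  define \<delta> where "\<delta> = min \<delta>0 (norm \<zeta>) / 2"
  have \<delta>: "\<delta> > 0" "\<delta> < \<delta>0" "\<delta> < norm \<zeta>"
    using \<delta>0(1) zero_less_norm_iff[THEN iffD2, OF \<zeta>] unfolding \<delta>_def by linarith+
  \<comment> \<open>Makes the comparison function at \<open>\<zeta>\<close> the midpoint of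
    \<open>c\<close> and \<open>V\<close>.\<close>
  define \<eta> where "\<eta> = (V - c) / (2 * ln (norm \<zeta> / \<delta>))"
  have L: "ln (norm \<zeta> / \<delta>) > 0" using \<delta> by (intro ln_gt_zero) simp
  have \<eta>: "\<eta> > 0" "\<eta> * ln (norm \<zeta> / \<delta>) = (V - c) / 2" using V L by (auto simp: \<eta>_def)
  \<comment> \<open>The second entry makes the comparison function nonnegative on
    \<open>norm \<xi> = R\<close>: its logarithmic term there is at least
    \<open>\<bar>c\<bar>\<close>.\<close>
  define R where "R = max (norm \<zeta>) (\<delta> * exp (\<bar>c\<bar> / \<eta>))"
  have R: "norm \<zeta> \<le> R" "R > 0" using \<zeta> by (auto simp: R_def less_max_iff_disj)
  have "\<delta> * exp (\<bar>c\<bar> / \<eta>) \<le> R" by (simp add: R_def)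
  hence "ln (\<delta> * exp (\<bar>c\<bar> / \<eta>)) \<le> ln R" using \<delta> R by (intro ln_mono) auto
  hence "\<bar>c\<bar> / \<eta> \<le> ln R - ln \<delta>" using \<delta> by (simp add: ln_mult)
  hence "\<bar>c\<bar> \<le> \<eta> * (ln R - ln \<delta>)" using \<eta> by (simp add: field_simps)
  hence outer0: "0 \<le> \<eta> * ln R + (c - \<eta> * ln \<delta>)" by (simp add: algebra_simps)
  have "v (f \<zeta>) \<le> ereal (\<eta> * ln (norm \<zeta>) + (c - \<eta> * ln \<delta>))"
  proof (rule psh_on_curve_annulus_le[OF G, where W = UNIV and \<delta> = \<delta> and R = R])
    show "v (f \<xi>) \<le> ereal (\<eta> * ln \<delta> + (c - \<eta> * ln \<delta>))" if "norm \<xi> = \<delta>" for \<xi>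
      using \<delta>0(2)[of \<xi>] \<delta> that by simp
    show "v (f \<xi>) \<le> ereal (\<eta> * ln R + (c - \<eta> * ln \<delta>))" if "norm \<xi> = R" for \<xi>
    proof -
      have "v (f \<xi>) \<le> 0" using G(3) fG by auto
      also have "0 \<le> ereal (\<eta> * ln R + (c - \<eta> * ln \<delta>))" using outer0 by simp
      finally show ?thesis .
    qed
  qed (use hol fG \<delta> R in auto)
  hence "V \<le> \<eta> * ln (norm \<zeta> / \<delta>) + c" using V \<zeta> \<delta> by (simp add: ln_div algebra_simps)
  hence "2 * V \<le> (V - c) + 2 * c" unfolding \<eta>(2) by (simp add: field_simps)
  thus False using V(2) by simp
qed

text \<open>The missing inequality is the same bound for the curve
  \<open>\<zeta> \<mapsto> f (1 - \<zeta>)\<close>, which exchanges the two endpoints.\<close>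

lemma psh_on_entire_curve_const:
  fixes v :: "complex^'n \<Rightarrow> ereal" and f :: "complex \<Rightarrow> complex^'n"
  assumes G: "open G" "psh_on G v" "\<And>z. z \<in> G \<Longrightarrow> v z \<le> 0"
    and hol: "\<And>j. (\<lambda>\<zeta>. f \<zeta> $ j) holomorphic_on UNIV" and fG: "range f \<subseteq> G"
  shows "v (f 1) = v (f 0)"
proof (rule antisym)
  show "v (f 1) \<le> v (f 0)" by (rule psh_on_entire_curve_le[OF assms])
  have "v (f (1 - 1)) \<le> v (f (1 - 0))"
    using fG by (intro psh_on_entire_curve_le[OF G, where f = "\<lambda>\<zeta>. f (1 - \<zeta>)"])
      (auto intro!: holomorphic_intros holomorphic_on_compose_gen[OF _ hol, unfolded o_def])
  thus "v (f 0) \<le> v (f 1)" by simp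
qed

text \<open>For \<open>\<kappa> < N\<close> and \<open>R' < R\<close> the comparison function is
  \<open>\<kappa> * (ln (norm \<xi>) - ln R')\<close>: it vanishes on the outer circle, and near 0
  the surplus \<open>(N - \<kappa>) * ln (norm \<xi>)\<close> tends to minus infinity and absorbs
  \<open>c\<close>. Then \<open>\<kappa>\<close> tends to \<open>N\<close> and \<open>R'\<close> to
  \<open>R\<close>.\<close>

lemma psh_on_curve_schwarz:
  fixes v :: "complex^'n \<Rightarrow> ereal" and f :: "complex \<Rightarrow> complex^'n"
  assumes G: "open G" "psh_on G v" "\<And>z. z \<in> G \<Longrightarrow> v z \<le> 0"
    and hol: "\<And>j. (\<lambda>\<zeta>. f \<zeta> $ j) holomorphic_on ball 0 R" and fG: "f ` ball 0 R \<subseteq> G"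
    and N: "N > 0" and \<delta>0: "\<delta>0 > 0"
    and near: "\<And>\<xi>. 0 < norm \<xi> \<Longrightarrow> norm \<xi> < \<delta>0 \<Longrightarrow> v (f \<xi>) \<le> ereal (N * ln (norm \<xi>) + c)"
    and \<zeta>: "0 < norm \<zeta>" "norm \<zeta> < R"
  shows "v (f \<zeta>) \<le> ereal (N * (ln (norm \<zeta>) - ln R))"
proof (cases "v (f \<zeta>) = -\<infinity>")
  case False
  have "v (f \<zeta>) \<le> 0" using G(3) fG \<zeta> by force
  with False obtain V where V: "v (f \<zeta>) = ereal V" by (cases "v (f \<zeta>)") auto
  have *: "V \<le> \<kappa> * (ln (norm \<zeta>) - ln R')" if \<kappa>: "0 < \<kappa>" "\<kappa> < N" and R': "norm \<zeta> < R'" "R' < R" for \<kappa> R'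
  proof -
    \<comment> \<open>Once \<open>ln \<delta> \<le> X\<close>, the growth bound lies under the
      comparison function on the inner circle.\<close>
    define X where "X = (- \<kappa> * ln R' - c) / (N - \<kappa>)"
    define \<delta> where "\<delta> = min (min \<delta>0 (norm \<zeta>) / 2) (exp X)"
    have \<delta>: "\<delta> > 0" "\<delta> < \<delta>0" "\<delta> < norm \<zeta>" "\<delta> \<le> exp X"
      using \<delta>0 \<zeta>(1) exp_gt_zero[of X] unfolding \<delta>_def by linarith+
    have "ln \<delta> \<le> X" using \<delta> ln_mono[of \<delta> "exp X"] by simp
    hence "(N - \<kappa>) * ln \<delta> \<le> - \<kappa> * ln R' - c" using \<kappa> by (simp add: X_def field_simps)
    hence \<delta>X: "N * ln \<delta> + c \<le> \<kappa> * ln \<delta> + - \<kappa> * ln R'" by (simp add: algebra_simps)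
    have "v (f \<zeta>) \<le> ereal (\<kappa> * ln (norm \<zeta>) + - \<kappa> * ln R')"
    proof (rule psh_on_curve_annulus_le[OF G, where W = "ball 0 R" and \<delta> = \<delta> and R = R'])
      show "v (f \<xi>) \<le> ereal (\<kappa> * ln \<delta> + - \<kappa> * ln R')" if "norm \<xi> = \<delta>" for \<xi>
        using near[of \<xi>] that \<delta> \<delta>X by (auto intro: order_trans)
      show "v (f \<xi>) \<le> ereal (\<kappa> * ln R' + - \<kappa> * ln R')" if "norm \<xi> = R'" for \<xi>
      proof -
        have "f \<xi> \<in> G" using fG that R' by force
        thus ?thesis using G(3)[of "f \<xi>"] by (simp add: zero_ereal_def)
      qed
    qed (use hol fG \<delta> \<zeta> R' in auto)
    thus ?thesis using V by (simp add: algebra_simps)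
  qed
  have **: "V \<le> N * (ln (norm \<zeta>) - ln R')" if R': "norm \<zeta> < R'" "R' < R" for R'
  proof (rule tendsto_lowerbound)
    show "((\<lambda>\<kappa>. \<kappa> * (ln (norm \<zeta>) - ln R')) \<longlongrightarrow> N * (ln (norm \<zeta>) - ln R')) (at_left N)"
      by (intro tendsto_intros)
    show "\<forall>\<^sub>F \<kappa> in at_left N. V \<le> \<kappa> * (ln (norm \<zeta>) - ln R')"
      using eventually_at_left_real[OF N] by eventually_elim (use * R' in auto)
  qed simp
  have "V \<le> N * (ln (norm \<zeta>) - ln R)"
  proof (rule tendsto_lowerbound)
    show "((\<lambda>R'. N * (ln (norm \<zeta>) - ln R')) \<longlongrightarrow> N * (ln (norm \<zeta>) - ln R)) (at_left R)"
      using \<zeta> by (intro tendsto_intros) auto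
    show "\<forall>\<^sub>F R' in at_left R. V \<le> N * (ln (norm \<zeta>) - ln R')"
      using eventually_at_left_real[OF \<zeta>(2)] by eventually_elim (use ** in auto)
  qed simp
  thus ?thesis using V by simp
qed simp

text \<open>A zero of a nonnegative function is a minimum, so the derivative vanishes at
  \<open>b\<close>; being differentiable there, it is \<open>O(norm (y - b))\<close>, and the mean
  value inequality gains another factor \<open>norm h\<close>.\<close>

lemma C2_on_nonneg_zero_imp_quadratic_bound:
  fixes u :: "'a::euclidean_space \<Rightarrow> real"
  assumes C2: "C2_on U u" and U: "open U" "b \<in> U" and nonneg: "\<And>x. x \<in> U \<Longrightarrow> u x \<ge> 0" and "u b = 0"
  shows "\<exists>C>0. \<exists>\<delta>>0. \<forall>h. norm h < \<delta> \<longrightarrow> u (b + h) \<le> C * (norm h)\<^sup>2"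
proof -
  obtain D D2 where D: "\<And>x. x \<in> U \<Longrightarrow> (u has_derivative D x) (at x)"
    and D2: "\<And>h x. x \<in> U \<Longrightarrow> ((\<lambda>y. D y h) has_derivative D2 x h) (at x)"
    using C2 unfolding C2_on_def by metis
  have Db: "D b = (\<lambda>_. 0)"
    using differential_zero_maxmin[OF U(2,1) D[OF U(2)]] nonneg \<open>u b = 0\<close> by auto
  \<comment> \<open>\<open>C2_on\<close> differentiates \<open>D y h\<close> only for fixed
    \<open>h\<close>, so the bound is obtained per basis vector and then summed to control the
    operator norm.\<close>
  have "\<exists>C>0. \<forall>\<^sub>F y in nhds b. \<bar>D y i\<bar> \<le> C * norm (y - b)" for i
  proof -
    obtain K where K: "K > 0" "\<And>k. norm (D2 b i k) \<le> norm k * K"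
      using bounded_linear.pos_bounded[OF has_derivative_bounded_linear[OF D2[OF U(2)]]] by blast
    obtain d where d: "d > 0" "\<And>y. norm (y - b) < d \<Longrightarrow> norm (D y i - D b i - D2 b i (y - b)) \<le> 1 * norm (y - b)"
      using D2[OF U(2), of i] unfolding has_derivative_at_alt using zero_less_one by blast
    have "\<bar>D y i\<bar> \<le> (K + 1) * norm (y - b)" if "dist y b < d" for y
    proof -
      have "\<bar>D y i\<bar> \<le> \<bar>D y i - D2 b i (y - b)\<bar> + \<bar>D2 b i (y - b)\<bar>" by simp
      also have "\<dots> \<le> norm (y - b) + norm (y - b) * K"
        using d(2)[of y] that K(2)[of "y - b"] Db by (intro add_mono) (auto simp: dist_norm)
      finally show ?thesis by (simp add: algebra_simps)
    qed
    thus ?thesis using d(1) K(1) unfolding eventually_nhds_metric by (intro exI[of _ "K + 1"]) auto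
  qed
  then obtain C where C: "\<And>i. C i > 0" "\<And>i. \<forall>\<^sub>F y in nhds b. \<bar>D y i\<bar> \<le> C i * norm (y - b)" by metis
  have "\<forall>\<^sub>F y in nhds b. y \<in> U \<and> (\<forall>i\<in>Basis. \<bar>D y i\<bar> \<le> C i * norm (y - b))"
    using C(2) U by (intro eventually_conj eventually_ball_finite eventually_nhds_in_open) auto
  then obtain \<delta> where \<delta>: "\<delta> > 0" "\<And>y. dist y b < \<delta> \<Longrightarrow> y \<in> U \<and> (\<forall>i\<in>Basis. \<bar>D y i\<bar> \<le> C i * norm (y - b))"
    unfolding eventually_nhds_metric by blast
  define S where "S = (\<Sum>i\<in>(Basis::'a set). C i)"
  have "S > 0" unfolding S_def using C(1) by (intro sum_pos) auto
  have "u (b + h) \<le> S * (norm h)\<^sup>2" if h: "norm h < \<delta>" for h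
  proof -
    have "norm (u (b + h) - u b) \<le> (S * norm h) * norm (b + h - b)"
    proof (rule differentiable_bound[where S = "cball b (norm h)" and f' = D])
      fix y assume y: "y \<in> cball b (norm h)"
      hence y': "dist y b < \<delta>" "norm (y - b) \<le> norm h" using h by (auto simp: dist_norm norm_minus_commute)
      thus "(u has_derivative D y) (at y within cball b (norm h))"
        using D \<delta>(2) has_derivative_at_withinI by blast
      show "onorm (D y) \<le> S * norm h"
      proof (rule onorm_le)
        fix x
        have lin: "linear (D y)" using D \<delta>(2) y'(1) has_derivative_linear by blast
        have "D y x = (\<Sum>i\<in>Basis. (x \<bullet> i) * D y i)"
          using linear_sum[OF lin, of "\<lambda>i. (x \<bullet> i) *\<^sub>R i" Basis] linear_scale[OF lin]
          by (simp add: euclidean_representation)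
        hence "norm (D y x) \<le> (\<Sum>i\<in>Basis. \<bar>x \<bullet> i\<bar> * \<bar>D y i\<bar>)"
          by (simp add: abs_mult[symmetric] sum_abs)
        also have "\<dots> \<le> (\<Sum>i\<in>Basis. norm x * (C i * norm h))"
        proof (intro sum_mono mult_mono)
          fix i :: 'a assume i: "i \<in> Basis"
          show "\<bar>x \<bullet> i\<bar> \<le> norm x" using Basis_le_norm[OF i] .
          have "\<bar>D y i\<bar> \<le> C i * norm (y - b)" using \<delta>(2) y' i by blast
          also have "\<dots> \<le> C i * norm h" using y' C(1)[of i] by simp
          finally show "\<bar>D y i\<bar> \<le> C i * norm h" .
        qed auto
        also have "\<dots> = S * norm h * norm x"
          by (simp add: S_def sum_distrib_left sum_distrib_right mult_ac)
        finally show "norm (D y x) \<le> S * norm h * norm x" .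
      qed
    qed (auto simp: dist_norm)
    thus ?thesis using \<open>u b = 0\<close> by (simp add: power2_eq_square)
  qed
  thus ?thesis using \<open>S > 0\<close> \<delta>(1) by blast
qed

section \<open>The upper bound\<close>

lemma elog_le_iff: "elog x \<le> ereal y \<longleftrightarrow> x \<le> exp y"
proof (cases "x \<le> 0")
  case True
  thus ?thesis using order_trans[OF True exp_ge_zero[of y]] by (simp add: elog_def)
next
  case False
  hence "ln x \<le> y \<longleftrightarrow> x \<le> exp y" by (metis exp_le_cancel_iff exp_ln not_le)
  thus ?thesis using False by (simp add: elog_def)
qed

lemma elog_eq_iff: "x \<ge> 0 \<Longrightarrow> y \<ge> 0 \<Longrightarrow> elog x = elog y \<longleftrightarrow> x = y"
  by (auto simp: elog_def)

lemma norm_axis: "norm (axis k x :: 'a::real_inner^'n) = norm x"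
  by (simp add: norm_eq_sqrt_inner inner_axis_axis)

lemma mpow_nonneg [simp]: "mpow t e \<ge> 0"
  by (simp add: mpow_def)

lemma mpow_eq_0_iff: "mpow t e = 0 \<longleftrightarrow> t = 0 \<and> e \<noteq> 0"
  by (simp add: mpow_def)

lemma mpow_0_right [simp]: "mpow t 0 = 1"
  by (simp add: mpow_def)

lemma zabs_nonneg [simp]: "zabs \<alpha> z \<ge> 0"
  by (simp add: zabs_def prod_nonneg)

lemma zabs_eq_0_iff: "zabs \<alpha> z = 0 \<longleftrightarrow> (\<exists>j. \<alpha> $ j \<noteq> 0 \<and> z $ j = 0)"
  by (auto simp: zabs_def mpow_eq_0_iff)

lemma continuous_on_zabs: "continuous_on {z. \<forall>j. \<alpha> $ j < 0 \<longrightarrow> z $ j \<noteq> 0} (zabs \<alpha>)"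
  unfolding zabs_def
proof (rule continuous_on_prod)
  fix j
  show "continuous_on {z. \<forall>j. \<alpha> $ j < 0 \<longrightarrow> z $ j \<noteq> 0} (\<lambda>z. mpow (norm (z $ j :: complex)) (\<alpha> $ j))"
  proof (cases "\<alpha> $ j = 0")
    case False
    have "continuous_on {z. \<forall>j. \<alpha> $ j < 0 \<longrightarrow> z $ j \<noteq> 0} (\<lambda>z. norm (z $ j :: complex) powr (\<alpha> $ j))"
      using False by (intro continuous_on_powr' continuous_intros) (auto, metis linorder_neqE_linordered_idom)
    thus ?thesis using False by (simp add: mpow_def)
  qed simp
qed

lemma open_Dalpha: "open (Dalpha \<alpha>)"
proof -
  have "{z::complex^'a. \<forall>j. \<alpha> $ j < 0 \<longrightarrow> z $ j \<noteq> 0} = (\<Inter>j\<in>{j. \<alpha> $ j < 0}. {z. z $ j \<noteq> 0})" by auto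
  moreover have "open {z::complex^'a. z $ j \<noteq> 0}" for j
    by (intro open_Collect_neq continuous_intros)
  ultimately have "open {z::complex^'a. \<forall>j. \<alpha> $ j < 0 \<longrightarrow> z $ j \<noteq> 0}" by auto
  moreover have "Dalpha \<alpha> = {z. \<forall>j. \<alpha> $ j < 0 \<longrightarrow> z $ j \<noteq> 0} \<inter> zabs \<alpha> -` {..<1}"
    by (auto simp: Dalpha_def)
  ultimately show ?thesis
    using continuous_open_preimage[OF continuous_on_zabs, of \<alpha> "{..<1}"] by simp
qed

section \<open>Nonpositive plurisubharmonic functions on \<open>Dalpha\<close>: constancy on
  hyperplanes and torus orbits\<close>

context
  fixes \<alpha> :: "real^'n" and v :: "complex^'n \<Rightarrow> ereal"
  assumes psh: "psh_on (Dalpha \<alpha>) v" and nonpos: "\<And>z. z \<in> Dalpha \<alpha> \<Longrightarrow> v z \<le> 0"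
begin

text \<open>An entire curve joins \<open>p\<close> to \<open>q\<close> inside the hyperplane, where
  \<open>zabs \<alpha>\<close> vanishes, so it stays in \<open>Dalpha \<alpha>\<close>. Coordinates
  with negative exponent must avoid 0 and move exponentially; the others move affinely.\<close>

lemma psh_on_Dalpha_const_on_coordinate_hyperplane:
  assumes "\<alpha> $ k > 0" "p $ k = 0" "q $ k = 0"
    and pq: "\<And>j. \<alpha> $ j < 0 \<Longrightarrow> p $ j \<noteq> 0" "\<And>j. \<alpha> $ j < 0 \<Longrightarrow> q $ j \<noteq> 0"
  shows "v q = v p"
proof -
  define f where "f = (\<lambda>\<zeta>. \<chi> j. if \<alpha> $ j < 0 then p $ j * exp (\<zeta> * Ln (q $ j / p $ j))
                                  else p $ j + \<zeta> * (q $ j - p $ j))"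
  have "f \<zeta> \<in> Dalpha \<alpha>" for \<zeta>
  proof -
    have "zabs \<alpha> (f \<zeta>) = 0" unfolding zabs_eq_0_iff using assms(1-3)
      by (intro exI[of _ k]) (simp add: f_def)
    thus ?thesis using pq by (auto simp: Dalpha_def f_def)
  qed
  moreover have "(\<lambda>\<zeta>. f \<zeta> $ j) holomorphic_on UNIV" for j
    by (cases "\<alpha> $ j < 0") (auto simp: f_def intro!: holomorphic_intros)
  ultimately have "v (f 1) = v (f 0)"
    by (intro psh_on_entire_curve_const[OF open_Dalpha psh nonpos]) auto
  moreover have "f 0 = p" by (simp add: f_def vec_eq_iff)
  moreover have "f 1 = q" using pq by (auto simp: f_def vec_eq_iff)
  ultimately show ?thesis by simp
qed

text \<open>Along \<open>\<zeta> \<mapsto> p $ j * exp (\<zeta> * L j)\<close> the value of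
  \<open>zabs\<close> is multiplied by
  \<open>exp (Re (\<zeta> * (\<Sum>j. \<alpha> $ j * L j))) = 1\<close>, so the curve stays in
  \<open>Dalpha \<alpha>\<close>. Coordinates with exponent 0 leave \<open>zabs\<close> unchanged
  and move affinely.\<close>

lemma psh_on_Dalpha_const_on_torus_orbit:
  assumes p: "p \<in> Dalpha \<alpha>" "\<And>j. \<alpha> $ j \<noteq> 0 \<Longrightarrow> p $ j \<noteq> 0"
    and q: "\<And>j. \<alpha> $ j \<noteq> 0 \<Longrightarrow> q $ j = p $ j * exp (L j)"
    and L: "(\<Sum>j\<in>UNIV. complex_of_real (\<alpha> $ j) * L j) = 0"
  shows "v q = v p" "zabs \<alpha> q = zabs \<alpha> p"
proof -
  define f where "f = (\<lambda>\<zeta>. \<chi> j. if \<alpha> $ j = 0 then p $ j + \<zeta> * (q $ j - p $ j)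
                                  else p $ j * exp (\<zeta> * L j))"
  have zabs_f: "zabs \<alpha> (f \<zeta>) = zabs \<alpha> p" for \<zeta>
  proof -
    have "zabs \<alpha> (f \<zeta>) = (\<Prod>j\<in>UNIV. mpow (norm (p $ j)) (\<alpha> $ j) * exp (\<alpha> $ j * Re (\<zeta> * L j)))"
      unfolding zabs_def
    proof (rule prod.cong)
      fix j
      show "mpow (norm (f \<zeta> $ j)) (\<alpha> $ j) = mpow (norm (p $ j)) (\<alpha> $ j) * exp (\<alpha> $ j * Re (\<zeta> * L j))"
      proof (cases "\<alpha> $ j = 0")
        case False
        have "exp (Re (\<zeta> * L j)) powr (\<alpha> $ j) = exp (\<alpha> $ j * Re (\<zeta> * L j))"
          by (simp add: powr_def)
        thus ?thesis using False by (simp add: f_def mpow_def norm_mult powr_mult del: times_complex.simps)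
      qed simp
    qed simp
    also have "\<dots> = zabs \<alpha> p * exp (\<Sum>j\<in>UNIV. \<alpha> $ j * Re (\<zeta> * L j))"
      by (simp add: prod.distrib zabs_def exp_sum del: times_complex.simps)
    also have "(\<Sum>j\<in>UNIV. \<alpha> $ j * Re (\<zeta> * L j)) = Re (\<zeta> * (\<Sum>j\<in>UNIV. of_real (\<alpha> $ j) * L j))"
      by (simp add: sum_distrib_left mult.left_commute del: times_complex.simps) (simp add: algebra_simps)
    finally show ?thesis using L by simp
  qed
  have "f \<zeta> \<in> Dalpha \<alpha>" for \<zeta>
    using zabs_f[of \<zeta>] p by (auto simp: Dalpha_def f_def)
  moreover have "(\<lambda>\<zeta>. f \<zeta> $ j) holomorphic_on UNIV" for j
    by (cases "\<alpha> $ j = 0") (auto simp: f_def intro!: holomorphic_intros)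
  ultimately have "v (f 1) = v (f 0)"
    by (intro psh_on_entire_curve_const[OF open_Dalpha psh nonpos]) auto
  moreover have "f 0 = p" by (simp add: f_def vec_eq_iff)
  moreover have f1: "f 1 = q" using q by (auto simp: f_def vec_eq_iff)
  ultimately show "v q = v p" by simp
  show "zabs \<alpha> q = zabs \<alpha> p" using zabs_f[of 1] f1 by simp
qed

end

text \<open>Every index \<open>k\<close> with positive exponent and \<open>a $ k = 0\<close> gives
  such a bound; since \<open>zabs \<alpha> z < 1\<close>, the smallest exponent gives the sharpest
  one.\<close>

lemma sibony_class_Dalpha_le:
  fixes \<alpha> :: "real^'n" and a :: "complex^'n"
  assumes u: "u \<in> sibony_class (Dalpha \<alpha>) a" and a: "a \<in> Dalpha \<alpha>"
    and k: "\<alpha> $ k > 0" "a $ k = 0" and z: "z \<in> Dalpha \<alpha>"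
  shows "u z \<le> zabs \<alpha> z powr (2 / \<alpha> $ k)"
proof -
  define v where "v = (\<lambda>z. elog (u z))"
  have range: "0 \<le> u w" "u w < 1" if "w \<in> Dalpha \<alpha>" for w using u that by (auto simp: sibony_class_def)
  have psh: "psh_on (Dalpha \<alpha>) v" using u by (simp add: sibony_class_def v_def)
  have nonpos: "v w \<le> 0" if "w \<in> Dalpha \<alpha>" for w
    using elog_le_iff[of "u w" 0] range[OF that] by (simp add: v_def zero_ereal_def)
  obtain U where U: "open U" "a \<in> U" "U \<subseteq> Dalpha \<alpha>" "C2_on U u" and ua: "u a = 0"
    using u by (auto simp: sibony_class_def)
  note hyper = psh_on_Dalpha_const_on_coordinate_hyperplane[OF psh nonpos]
  have zero: "u w = 0" if w: "w \<in> Dalpha \<alpha>" "zabs \<alpha> w = 0" for w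
  proof -
    obtain j where j: "\<alpha> $ j \<noteq> 0" "w $ j = 0" using w by (auto simp: zabs_eq_0_iff)
    hence "\<alpha> $ j > 0" using w(1) by (force simp: Dalpha_def)
    \<comment> \<open>\<open>w'\<close> lies on both hyperplanes \<open>z $ j = 0\<close> and
      \<open>z $ k = 0\<close>, so it links \<open>w\<close> to \<open>a\<close> in two
      moves.\<close>
    define w' where "w' = (\<chi> i. if i = k then 0 else w $ i)"
    have w': "\<And>i. \<alpha> $ i < 0 \<Longrightarrow> w' $ i \<noteq> 0" using w(1) k by (auto simp: Dalpha_def w'_def)
    have "v w = v w'"
      using w(1) w' j \<open>\<alpha> $ j > 0\<close> by (intro hyper[of j]) (auto simp: Dalpha_def w'_def)
    also have "\<dots> = v a"
      using a w' k by (intro hyper[of k]) (auto simp: Dalpha_def w'_def)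
    finally show ?thesis using elog_eq_iff[of "u w" "u a"] range[OF w(1)] range[OF a] ua by (simp add: v_def)
  qed
  txt \<open>Near \<^term>\<open>a\<close> there is a point \<open>b\<close> of the zero set of \<^term>\<open>u\<close> whose only vanishing relevant
    coordinate is the \<open>k\<close>-th; there \<open>u = O(norm \<xi>\<^sup>2)\<close> in the direction of that coordinate.\<close>
  define B where "B = (\<lambda>s::real. \<chi> j. if \<alpha> $ j \<noteq> 0 \<and> a $ j = 0 \<and> j \<noteq> k then complex_of_real s else a $ j)"
  have "((\<lambda>s. B s $ j) \<longlongrightarrow> a $ j) (at_right 0)" for j
    by (cases "\<alpha> $ j \<noteq> 0 \<and> a $ j = 0 \<and> j \<noteq> k") (auto simp: B_def intro!: tendsto_eq_intros)
  hence "(B \<longlongrightarrow> a) (at_right 0)" by (intro vec_tendstoI)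
  hence "\<forall>\<^sub>F s in at_right 0. B s \<in> U" using U by (auto simp: tendsto_def)
  moreover have "\<forall>\<^sub>F s::real in at_right 0. s > 0" by (simp add: eventually_at_right_less)
  ultimately have "\<forall>\<^sub>F s in at_right 0. B s \<in> U \<and> s > 0" by (rule eventually_conj)
  then obtain s where s: "B s \<in> U" "s > 0" using eventually_happens[of _ "at_right (0::real)"] by auto
  define b where "b = B s"
  have b: "b \<in> U" "b \<in> Dalpha \<alpha>" "b $ k = 0" "\<And>j. \<alpha> $ j \<noteq> 0 \<Longrightarrow> j \<noteq> k \<Longrightarrow> b $ j \<noteq> 0"
    using s U k by (auto simp: b_def B_def)
  have "zabs \<alpha> b = 0" unfolding zabs_eq_0_iff using k b by (intro exI[of _ k]) auto
  hence "u b = 0" using zero b by blast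
  then obtain C \<delta> where C: "C > 0" "\<delta> > 0" "\<And>h. norm h < \<delta> \<Longrightarrow> u (b + h) \<le> C * (norm h)\<^sup>2"
    using C2_on_nonneg_zero_imp_quadratic_bound[OF U(4,1) b(1)] range U(3) by blast
  define f where "f = (\<lambda>\<xi>. \<chi> j. if j = k then \<xi> else b $ j)"
  have f_eq: "f \<xi> = b + axis k \<xi>" for \<xi> using b(3) by (auto simp: f_def vec_eq_iff axis_def)
  define Q where "Q = (\<Prod>j\<in>UNIV - {k}. mpow (norm (b $ j)) (\<alpha> $ j))"
  have "Q \<noteq> 0" unfolding Q_def using b(4) by (auto simp: mpow_eq_0_iff)
  moreover have "Q \<ge> 0" unfolding Q_def by (intro prod_nonneg) simp
  ultimately have Q: "Q > 0" by simp
  have zabs_f: "zabs \<alpha> (f \<xi>) = norm \<xi> powr (\<alpha> $ k) * Q" for \<xi>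
  proof -
    have "zabs \<alpha> (f \<xi>) = mpow (norm (f \<xi> $ k)) (\<alpha> $ k) * (\<Prod>j\<in>UNIV - {k}. mpow (norm (f \<xi> $ j)) (\<alpha> $ j))"
      unfolding zabs_def by (rule prod.remove) auto
    also have "(\<Prod>j\<in>UNIV - {k}. mpow (norm (f \<xi> $ j)) (\<alpha> $ j)) = Q"
      unfolding Q_def by (intro prod.cong) (auto simp: f_def)
    finally show ?thesis using k by (simp add: f_def mpow_def)
  qed
  \<comment> \<open>The radius at which \<open>zabs \<alpha> (f \<xi>)\<close> reaches 1; below it
    the disc lies in \<open>Dalpha \<alpha>\<close>.\<close>
  define R where "R = exp (- ln Q / \<alpha> $ k)"
  have R: "R > 0" "R powr (\<alpha> $ k) * Q = 1" "ln R = - ln Q / \<alpha> $ k"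
    using Q k by (auto simp: R_def powr_def) (simp add: exp_minus)
  have zabs_f_less: "zabs \<alpha> (f \<xi>) < 1 \<longleftrightarrow> norm \<xi> < R" for \<xi>
  proof -
    have "zabs \<alpha> (f \<xi>) < 1 \<longleftrightarrow> norm \<xi> powr (\<alpha> $ k) < R powr (\<alpha> $ k)"
      using R(2) Q by (metis zabs_f mult_less_cancel_right_pos)
    also have "\<dots> \<longleftrightarrow> norm \<xi> < R"
      using k R powr_less_mono2[of "\<alpha> $ k" "norm \<xi>" R] powr_mono2[of "\<alpha> $ k" R "norm \<xi>"]
      by (meson less_eq_real_def norm_ge_zero not_le)
    finally show ?thesis .
  qed
  have fG: "f ` ball 0 R \<subseteq> Dalpha \<alpha>"
    using b(2) k zabs_f_less by (auto simp: Dalpha_def f_def split: if_splits)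
  have slice: "u (f \<xi>) \<le> zabs \<alpha> (f \<xi>) powr (2 / \<alpha> $ k)" if \<xi>: "0 < norm \<xi>" "norm \<xi> < R" for \<xi>
  proof -
    have "v (f \<xi>) \<le> ereal (2 * (ln (norm \<xi>) - ln R))"
    proof (rule psh_on_curve_schwarz[OF open_Dalpha psh nonpos _ fG _ C(2) _ \<xi>])
      show "(\<lambda>\<zeta>. f \<zeta> $ j) holomorphic_on ball 0 R" for j
        by (cases "j = k") (auto simp: f_def intro!: holomorphic_intros)
      show "v (f \<eta>) \<le> ereal (2 * ln (norm \<eta>) + ln C)" if "0 < norm \<eta>" "norm \<eta> < \<delta>" for \<eta>
      proof -
        have "u (f \<eta>) \<le> C * (norm \<eta>)\<^sup>2" using C(3)[of "axis k \<eta>"] that by (simp add: f_eq norm_axis)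
        also have "\<dots> = exp (2 * ln (norm \<eta>) + ln C)"
          using that C(1) by (simp add: exp_add exp_double)
        finally show ?thesis unfolding v_def elog_le_iff .
      qed
    qed auto
    hence "u (f \<xi>) \<le> exp (2 * (ln (norm \<xi>) - ln R))" by (simp add: v_def elog_le_iff)
    also have "\<dots> = zabs \<alpha> (f \<xi>) powr (2 / \<alpha> $ k)"
      using \<xi> Q k R(3) by (simp add: zabs_f powr_def ln_mult field_simps)
    finally show ?thesis .
  qed
  show ?thesis
  proof (cases "zabs \<alpha> z = 0")
    case True
    thus ?thesis using zero[OF z] by simp
  next
    case False
    hence znz: "z $ j \<noteq> 0" if "\<alpha> $ j \<noteq> 0" for j using that by (auto simp: zabs_eq_0_iff)
    \<comment> \<open>For \<open>j \<noteq> k\<close> with \<open>\<alpha> $ j \<noteq> 0\<close>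
      the factor \<open>exp (L0 j)\<close> moves \<open>z $ j\<close> to \<open>b $ j\<close>; the
      entry of \<open>L\<close> at \<open>k\<close> is then forced by
      \<open>(\<Sum>j. \<alpha> $ j * L j) = 0\<close> and determines the point \<open>\<xi>\<close>
      of the disc.\<close>
    define L0 where "L0 = (\<lambda>j. Ln (b $ j / z $ j))"
    define L where "L = L0 (k := - (\<Sum>j\<in>UNIV - {k}. of_real (\<alpha> $ j) * L0 j) / of_real (\<alpha> $ k))"
    define \<xi> where "\<xi> = z $ k * exp (L k)"
    have \<xi>: "\<xi> \<noteq> 0" using znz k by (simp add: \<xi>_def)
    have "(\<Sum>j\<in>UNIV. of_real (\<alpha> $ j) * L j) = of_real (\<alpha> $ k) * L k + (\<Sum>j\<in>UNIV - {k}. of_real (\<alpha> $ j) * L j)"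
      by (rule sum.remove) auto
    also have "(\<Sum>j\<in>UNIV - {k}. of_real (\<alpha> $ j) * L j) = (\<Sum>j\<in>UNIV - {k}. of_real (\<alpha> $ j) * L0 j)"
      by (intro sum.cong) (auto simp: L_def)
    finally have L: "(\<Sum>j\<in>UNIV. complex_of_real (\<alpha> $ j) * L j) = 0" using k by (simp add: L_def)
    have f\<xi>: "f \<xi> $ j = z $ j * exp (L j)" if "\<alpha> $ j \<noteq> 0" for j
      using znz[OF that] b(4)[OF that] by (cases "j = k") (auto simp: f_def \<xi>_def L_def L0_def)
    note orbit = psh_on_Dalpha_const_on_torus_orbit[OF psh nonpos z znz f\<xi> L]
    have "norm \<xi> < R" using orbit(2) z zabs_f_less[of \<xi>] by (simp add: Dalpha_def)
    hence "f \<xi> \<in> Dalpha \<alpha>" using fG by auto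
    hence "u (f \<xi>) = u z" using orbit(1) elog_eq_iff range z by (simp add: v_def)
    thus ?thesis using slice[of \<xi>] \<xi> \<open>norm \<xi> < R\<close> orbit(2) by simp
  qed
qed

section \<open>Plurisubharmonicity of the extremal function\<close>

text \<open>\<open>Ln (1 + \<zeta> * (B / A))\<close> is holomorphic on the closed unit disc, since
  its argument has positive real part there; at the centre it is 0.\<close>

lemma circle_mean_ln_norm_affine_aux:
  fixes A B :: complex
  assumes "norm B < norm A"
  shows "((\<lambda>t. ln (norm (A + B * cis t))) has_integral 2 * pi * ln (norm A)) {0..2*pi}"
proof -
  have A: "A \<noteq> 0" using assms by auto
  have *: "Re (1 + \<zeta> * (B / A)) > 0" if "\<zeta> \<in> cball 0 1" for \<zeta>
  proof -
    have "norm (\<zeta> * (B / A)) \<le> 1 * norm (B / A)"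
      unfolding norm_mult using that by (intro mult_right_mono) auto
    also have "\<dots> < 1" using assms A by (simp add: norm_divide)
    finally have "\<bar>Re (\<zeta> * (B / A))\<bar> < 1" using abs_Re_le_cmod order_le_less_trans by blast
    thus ?thesis unfolding plus_complex.sel one_complex.sel by linarith
  qed
  hence "1 + \<zeta> * (B / A) \<notin> \<real>\<^sub>\<le>\<^sub>0" if "\<zeta> \<in> cball 0 1" for \<zeta>
    using that unfolding complex_nonpos_Reals_iff by (meson not_le)
  hence "(\<lambda>\<zeta>. Ln (1 + \<zeta> * (B / A)) + of_real (ln (norm A))) holomorphic_on cball 0 1"
    by (intro holomorphic_intros) auto
  from Re_holomorphic_circle_mean[OF this zero_less_one]
  have "((\<lambda>t. Re (Ln (1 + cis t * (B / A)) + of_real (ln (norm A)))) has_integral 2 * pi * ln (norm A)) {0..2*pi}"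
    by simp
  thus ?thesis
  proof (rule has_integral_eq[rotated])
    fix t :: real
    have "Re (1 + cis t * (B / A)) > 0" by (rule *) simp
    hence nz: "1 + cis t * (B / A) \<noteq> 0" by (metis less_irrefl zero_complex.sel(1))
    have "Re (Ln (1 + cis t * (B / A)) + of_real (ln (norm A))) = ln (norm (1 + cis t * (B / A)) * norm A)"
      using nz A by (simp add: ln_mult)
    also have "norm (1 + cis t * (B / A)) * norm A = norm (A + B * cis t)"
      unfolding norm_mult[symmetric] using A by (simp add: distrib_right) (simp add: mult.commute)
    finally show "Re (Ln (1 + cis t * (B / A)) + of_real (ln (norm A))) = ln (norm (A + B * cis t))" .
  qed
qed

text \<open>Jensen's formula for an affine function. If \<open>norm A < norm B\<close>, conjugation
  followed by multiplication with \<open>cis t\<close> exchanges \<open>A\<close> and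
  \<open>B\<close>, up to conjugates, without changing the norm.\<close>

lemma circle_mean_ln_norm_affine:
  fixes A B :: complex
  assumes "norm A \<noteq> norm B"
  shows "((\<lambda>t. ln (norm (A + B * cis t))) has_integral 2 * pi * ln (max (norm A) (norm B))) {0..2*pi}"
proof (cases "norm B < norm A")
  case True
  thus ?thesis using circle_mean_ln_norm_affine_aux[OF True] by (simp add: max_def)
next
  case False
  hence *: "norm (cnj A) < norm (cnj B)" using assms by simp
  have "norm (cnj B + cnj A * cis t) = norm (A + B * cis t)" for t
  proof -
    have "norm (A + B * cis t) = norm (cnj (A + B * cis t) * cis t)"
      by (metis complex_mod_cnj mult.right_neutral norm_cis norm_mult)
    also have "cnj (A + B * cis t) * cis t = cnj B * (cis (-t) * cis t) + cnj A * cis t"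
      by (simp add: algebra_simps cis_cnj)
    also have "cis (-t) * cis t = 1" by (simp add: cis_mult)
    finally show ?thesis by simp
  qed
  thus ?thesis using circle_mean_ln_norm_affine_aux[OF *] False by (simp add: max_def)
qed

lemma ln_zabs:
  assumes "\<And>j. \<alpha> $ j \<noteq> 0 \<Longrightarrow> z $ j \<noteq> 0"
  shows "ln (zabs \<alpha> z) = (\<Sum>j\<in>UNIV. \<alpha> $ j * ln (norm (z $ j)))"
proof -
  have "ln (zabs \<alpha> z) = (\<Sum>j\<in>UNIV. ln (mpow (norm (z $ j)) (\<alpha> $ j)))"
    unfolding zabs_def
  proof (rule ln_prod)
    show "mpow (norm (z $ j)) (\<alpha> $ j) \<noteq> 0" for j
      using assms[of j] by (auto simp: mpow_eq_0_iff)
  qed simp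
  also have "\<dots> = (\<Sum>j\<in>UNIV. \<alpha> $ j * ln (norm (z $ j)))"
    using assms by (intro sum.cong) (auto simp: mpow_def ln_powr)
  finally show ?thesis .
qed

lemma usc_on_subset: "usc_on S w \<Longrightarrow> T \<subseteq> S \<Longrightarrow> usc_on T w"
  unfolding usc_on_def by (meson at_le filter_leD subsetD)

lemma subharmonic_on_subset:
  assumes "subharmonic_on S w" "T \<subseteq> S"
  shows "subharmonic_on T w"
  using assms usc_on_subset[of S w T] subset_trans[OF _ assms(2)]
  unfolding subharmonic_on_def by blast

lemma psh_on_subset:
  assumes "psh_on G v" "H \<subseteq> G"
  shows "psh_on H v"
  unfolding psh_on_def
proof (intro conjI ballI allI)
  show "usc_on H v" using assms usc_on_subset by (auto simp: psh_on_def)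
  fix p b assume "p \<in> H"
  hence "p \<in> G" using assms(2) by blast
  from psh_on_lineD[OF assms(1) this]
  show "subharmonic_on {w. p + (\<chi> j. w * b $ j) \<in> H} (\<lambda>w. v (p + (\<chi> j. w * b $ j)))"
    by (rule subharmonic_on_subset) (use assms(2) in auto)
qed

lemma usc_on_elog:
  assumes "continuous_on S F"
  shows "usc_on S (\<lambda>x. elog (F x))"
  unfolding usc_on_def
proof (intro ballI allI impI)
  fix x c assume x: "x \<in> S" "elog (F x) < c"
  obtain d where d: "elog (F x) < ereal d" "ereal d < c" using ereal_dense2 x by blast
  obtain d' where d': "elog (F x) < ereal d'" "d' < d" using ereal_dense2[OF d(1)] by auto
  have "F x \<le> exp d'" using less_imp_le[OF d'(1)] by (simp only: elog_le_iff)
  also have "\<dots> < exp d" using d' by simp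
  finally have "\<forall>\<^sub>F y in at x within S. F y < exp d"
    using assms x by (intro order_tendstoD(2)[where y = "F x"]) (auto simp: continuous_on)
  thus "\<forall>\<^sub>F y in at x within S. elog (F y) < c"
  proof eventually_elim
    case (elim y)
    hence "elog (F y) \<le> ereal d" by (simp add: elog_le_iff)
    thus ?case using d(2) by simp
  qed
qed

text \<open>Jensen's formula in each coordinate. For positive exponents the mean is at least the
  central value; for negative ones \<open>neg\<close> keeps the zero out of the disc, so the mean
  equals it.\<close>

lemma zabs_circle_mean:
  assumes nz: "\<And>j. \<alpha> $ j \<noteq> 0 \<Longrightarrow> A $ j \<noteq> 0 \<and> norm (A $ j) \<noteq> norm (B $ j)"
    and neg: "\<And>j. \<alpha> $ j < 0 \<Longrightarrow> norm (B $ j) < norm (A $ j)"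
  shows "\<exists>I. ((\<lambda>t. ln (zabs \<alpha> (\<chi> j. A $ j + B $ j * cis t))) has_integral I) {0..2*pi} \<and>
             2 * pi * ln (zabs \<alpha> A) \<le> I"
proof (intro exI conjI)
  define I where "I = (\<Sum>j\<in>UNIV. \<alpha> $ j * (2 * pi * ln (max (norm (A $ j)) (norm (B $ j)))))"
  have "A $ j + B $ j * cis t \<noteq> 0" if "\<alpha> $ j \<noteq> 0" for j t
  proof
    assume "A $ j + B $ j * cis t = 0"
    hence "norm (A $ j) = norm (- (B $ j * cis t))" by (simp only: eq_neg_iff_add_eq_0[symmetric])
    thus False using nz[OF that] by (simp add: norm_mult)
  qed
  hence eq: "ln (zabs \<alpha> (\<chi> j. A $ j + B $ j * cis t)) = (\<Sum>j\<in>UNIV. \<alpha> $ j * ln (norm (A $ j + B $ j * cis t)))" for t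
    by (subst ln_zabs) auto
  have "((\<lambda>t. \<alpha> $ j * ln (norm (A $ j + B $ j * cis t))) has_integral
          \<alpha> $ j * (2 * pi * ln (max (norm (A $ j)) (norm (B $ j))))) {0..2*pi}" for j
    using nz[of j] by (cases "\<alpha> $ j = 0") (auto intro!: has_integral_mult_right circle_mean_ln_norm_affine)
  thus "((\<lambda>t. ln (zabs \<alpha> (\<chi> j. A $ j + B $ j * cis t))) has_integral I) {0..2*pi}"
    unfolding eq I_def by (intro has_integral_sum) auto
  have "\<alpha> $ j * ln (norm (A $ j)) \<le> \<alpha> $ j * ln (max (norm (A $ j)) (norm (B $ j)))" for j
  proof (cases "\<alpha> $ j > 0")
    case True
    thus ?thesis using nz[of j] by (intro mult_left_mono ln_mono) auto
  next
    case False
    thus ?thesis using neg[of j] by (cases "\<alpha> $ j = 0") (auto simp: max_def)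
  qed
  hence "2 * pi * (\<alpha> $ j * ln (norm (A $ j))) \<le> \<alpha> $ j * (2 * pi * ln (max (norm (A $ j)) (norm (B $ j))))" for j
    using mult_left_mono[of _ _ "2 * pi"] by (simp add: mult.left_commute)
  thus "2 * pi * ln (zabs \<alpha> A) \<le> I"
    using nz by (subst ln_zabs) (auto simp: I_def sum_distrib_left intro!: sum_mono)
qed

text \<open>Where the value at the centre is minus infinity the mean inequality is trivial.
  Elsewhere \<open>zabs_circle_mean\<close> gives it on slightly smaller circles, and uniform
  continuity carries over the majorant \<open>g\<close> with an error
  \<open>\<epsilon>\<close>.\<close>

lemma psh_on_elog_zabs:
  fixes \<alpha> :: "real^'n"
  shows "psh_on {z. \<forall>j. \<alpha> $ j < 0 \<longrightarrow> z $ j \<noteq> 0} (\<lambda>z. elog (zabs \<alpha> z))"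
  unfolding psh_on_def
proof (intro conjI ballI allI)
  define G where "G = {z :: complex^'n. \<forall>j. \<alpha> $ j < 0 \<longrightarrow> z $ j \<noteq> 0}"
  have cont: "continuous_on G (zabs \<alpha>)" unfolding G_def by (rule continuous_on_zabs)
  show "usc_on {z. \<forall>j. \<alpha> $ j < 0 \<longrightarrow> z $ j \<noteq> 0} (\<lambda>z. elog (zabs \<alpha> z))"
    using usc_on_elog[OF cont] by (simp add: G_def)
  fix p b :: "complex^'n"
  define l where "l = (\<lambda>w. p + (\<chi> j. w * b $ j))"
  have lc: "continuous_on S l" for S unfolding l_def
    by (intro continuous_intros continuous_on_vec_lambda)
  define F where "F = (\<lambda>w. zabs \<alpha> (l w))"
  have Fc: "continuous_on {w. l w \<in> G} F"
    unfolding F_def by (intro continuous_on_compose2[OF cont lc]) auto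
  have "subharmonic_on {w. l w \<in> G} (\<lambda>w. elog (F w))"
    unfolding subharmonic_on_def
  proof (intro conjI allI impI ballI)
    show "usc_on {w. l w \<in> G} (\<lambda>w. elog (F w))" by (rule usc_on_elog[OF Fc])
    show "elog (F x) < \<infinity>" for x by (simp add: elog_def)
    fix z0 :: complex and r :: real and g :: "complex \<Rightarrow> real"
    assume r: "0 < r \<and> cball z0 r \<subseteq> {w. l w \<in> G}"
      and g: "continuous_on (sphere z0 r) g \<and> (\<forall>\<zeta>\<in>sphere z0 r. elog (F \<zeta>) \<le> ereal (g \<zeta>))"
    define J where "J = integral {0..2*pi} (\<lambda>t. g (z0 + complex_of_real r * cis t))"
    have circ: "z0 + complex_of_real r * cis t \<in> sphere z0 r" for t
      using r by (simp add: dist_norm norm_mult)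
    have "continuous_on {0..2*pi} (\<lambda>t. g (z0 + complex_of_real r * cis t))"
      using circ by (intro continuous_on_compose2[OF conjunct1[OF g]] continuous_on_add continuous_on_mult
        continuous_on_cis continuous_on_const continuous_on_id) blast
    hence J: "((\<lambda>t. g (z0 + complex_of_real r * cis t)) has_integral J) {0..2*pi}"
      unfolding J_def by (intro integrable_integral integrable_continuous_real)
    show "elog (F z0) \<le> ereal (1 / (2 * pi) * integral {0..2*pi} (\<lambda>t. g (z0 + complex_of_real r * cis t)))"
    proof (cases "F z0 = 0")
      case False
      define A where "A = l z0"
      have A: "A $ j \<noteq> 0" if "\<alpha> $ j \<noteq> 0" for j
        using False that by (auto simp: F_def zabs_eq_0_iff A_def)
      have "2 * pi * ln (F z0) \<le> J + e" if e: "e > 0" for e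
      proof -
        txt \<open>The factors may vanish on the circle of radius \<^term>\<open>r\<close>, so the mean is taken over a
          slightly smaller circle avoiding their finitely many zeros.\<close>
        define \<epsilon> where "\<epsilon> = e / (2 * pi)"
        have \<epsilon>: "\<epsilon> > 0" "2 * pi * \<epsilon> = e" using e by (auto simp: \<epsilon>_def)
        have "compact (g ` sphere z0 r)" using g by (intro compact_continuous_image) auto
        then obtain m where "\<forall>\<zeta>\<in>sphere z0 r. \<bar>g \<zeta>\<bar> \<le> m"
          unfolding compact_eq_bounded_closed bounded_pos by auto
        hence m: "\<bar>g \<zeta>\<bar> \<le> m" if "\<zeta> \<in> sphere z0 r" for \<zeta> using that by blast
        \<comment> \<open>Since \<open>g \<ge> - m\<close> on the circle, adding
          \<open>\<eta>\<close> to \<open>exp (g \<zeta>)\<close> costs at most a factor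
          \<open>exp \<epsilon>\<close>; this controls \<open>F\<close> nearby even if it vanishes
          on the outer circle.\<close>
        define \<eta> where "\<eta> = exp (-m) * (exp \<epsilon> - 1)"
        have \<eta>: "\<eta> > 0" using \<epsilon> by (simp add: \<eta>_def)
        have "uniformly_continuous_on (cball z0 r) F"
          using r by (intro compact_uniformly_continuous continuous_on_subset[OF Fc]) auto
        then obtain \<delta> where \<delta>: "\<delta> > 0"
          "\<And>x y. x \<in> cball z0 r \<Longrightarrow> y \<in> cball z0 r \<Longrightarrow> dist y x < \<delta> \<Longrightarrow> dist (F y) (F x) < \<eta>"
          unfolding uniformly_continuous_on_def using \<eta> by metis
        have "infinite {max 0 (r - \<delta>)<..<r}" using r \<delta> by (intro infinite_Ioo) auto
        hence "infinite ({max 0 (r - \<delta>)<..<r} - (\<lambda>j. norm (A $ j) / norm (b $ j)) ` UNIV)"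
          by (rule Diff_infinite_finite[rotated]) simp
        then obtain \<rho> where "\<rho> \<in> {max 0 (r - \<delta>)<..<r} - (\<lambda>j. norm (A $ j) / norm (b $ j)) ` UNIV"
          using infinite_imp_nonempty by blast
        hence \<rho>: "0 < \<rho>" "r - \<delta> < \<rho>" "\<rho> < r" "\<And>j. \<rho> \<noteq> norm (A $ j) / norm (b $ j)"
          by auto
        define B where "B = (\<chi> j. complex_of_real \<rho> * b $ j)"
        have "\<exists>I. ((\<lambda>t. ln (zabs \<alpha> (\<chi> j. A $ j + B $ j * cis t))) has_integral I) {0..2*pi} \<and>
             2 * pi * ln (zabs \<alpha> A) \<le> I"
        proof (rule zabs_circle_mean)
          show "A $ j \<noteq> 0 \<and> norm (A $ j) \<noteq> norm (B $ j)" if "\<alpha> $ j \<noteq> 0" for j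
            using A[OF that] \<rho>(1) \<rho>(4)[of j] by (cases "b $ j = 0") (auto simp: B_def norm_mult field_simps)
          show "norm (B $ j) < norm (A $ j)" if "\<alpha> $ j < 0" for j
          proof (rule ccontr)
            assume "\<not> norm (B $ j) < norm (A $ j)"
            hence le: "norm (A $ j) \<le> \<rho> * norm (b $ j)" using \<rho> by (simp add: B_def norm_mult)
            have "A $ j \<noteq> 0" using A that by simp
            hence bj: "b $ j \<noteq> 0" using le by auto
            \<comment> \<open>The zero of the \<open>j\<close>-th coordinate along the line; it
              would lie in the disc, although coordinates with negative exponent do not vanish on
              \<open>G\<close>.\<close>
            define w where "w = z0 - A $ j / b $ j"
            have "dist z0 w \<le> r" using le bj \<rho> unfolding w_def dist_norm
              by (simp add: norm_divide divide_le_eq) (smt (verit) mult_right_mono norm_ge_zero)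
            hence "l w \<in> G" using r by auto
            hence "l w $ j \<noteq> 0" using that by (simp add: G_def)
            thus False using bj by (simp add: l_def w_def A_def field_simps)
          qed
        qed
        then obtain I where I: "((\<lambda>t. ln (zabs \<alpha> (\<chi> j. A $ j + B $ j * cis t))) has_integral I) {0..2*pi}"
             "2 * pi * ln (zabs \<alpha> A) \<le> I" by blast
        have "I \<le> J + 2 * pi * \<epsilon>"
        proof (rule has_integral_le[OF I(1)])
          show "((\<lambda>t. g (z0 + complex_of_real r * cis t) + \<epsilon>) has_integral J + 2 * pi * \<epsilon>) {0..2*pi}"
            using has_integral_add[OF J has_integral_const_real[of \<epsilon> 0 "2 * pi"]] by simp
          fix t :: real
          have AB: "(\<chi> j. A $ j + B $ j * cis t) = l (z0 + \<rho> * cis t)"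
            by (simp add: vec_eq_iff A_def l_def B_def algebra_simps)
          define \<gamma> where "\<gamma> = g (z0 + r * cis t)"
          have "dist (z0 + \<rho> * cis t) (z0 + r * cis t) = norm (complex_of_real (\<rho> - r) * cis t)"
            by (simp add: dist_norm algebra_simps)
          also have "\<dots> = r - \<rho>" using \<rho> unfolding norm_mult norm_of_real by simp
          finally have "dist (F (z0 + \<rho> * cis t)) (F (z0 + r * cis t)) < \<eta>"
            using \<rho> r circ[of t] by (intro \<delta>(2)) (auto simp: dist_norm norm_mult)
          hence "F (z0 + \<rho> * cis t) \<le> F (z0 + r * cis t) + \<eta>" unfolding dist_real_def by linarith
          also have "F (z0 + r * cis t) \<le> exp \<gamma>"
            using g circ[of t] elog_le_iff by (simp add: \<gamma>_def)
          also have "\<eta> \<le> exp \<gamma> * (exp \<epsilon> - 1)"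
            unfolding \<eta>_def \<gamma>_def using m[OF circ[of t]] \<epsilon> by (intro mult_right_mono) auto
          also have "exp \<gamma> + exp \<gamma> * (exp \<epsilon> - 1) = exp (\<gamma> + \<epsilon>)" by (simp add: exp_add algebra_simps)
          finally have F_le: "F (z0 + \<rho> * cis t) \<le> exp (\<gamma> + \<epsilon>)" by simp
          have "F (z0 + \<rho> * cis t) > 0"
          proof -
            have "l (z0 + \<rho> * cis t) $ j \<noteq> 0" if "\<alpha> $ j \<noteq> 0" for j
            proof
              assume "l (z0 + \<rho> * cis t) $ j = 0"
              hence "A $ j + B $ j * cis t = 0" unfolding AB[symmetric] by simp
              hence "norm (A $ j) = norm (- (B $ j * cis t))" by (simp only: eq_neg_iff_add_eq_0[symmetric])
              hence "norm (A $ j) = \<rho> * norm (b $ j)" using \<rho> by (simp add: norm_mult B_def)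
              thus False using \<rho>(4)[of j] A[OF that] by (cases "b $ j = 0") auto
            qed
            hence "F (z0 + \<rho> * cis t) \<noteq> 0" by (auto simp: F_def zabs_eq_0_iff)
            thus ?thesis by (simp add: F_def less_le)
          qed
          hence "ln (F (z0 + \<rho> * cis t)) \<le> \<gamma> + \<epsilon>" using F_le by (metis exp_le_cancel_iff exp_ln)
          thus "ln (zabs \<alpha> (\<chi> j. A $ j + B $ j * cis t)) \<le> g (z0 + complex_of_real r * cis t) + \<epsilon>"
            unfolding AB by (simp only: F_def \<gamma>_def)
        qed
        thus ?thesis using I(2) \<epsilon>(2) by (simp add: F_def A_def)
      qed
      hence "2 * pi * ln (F z0) \<le> J" by (rule field_le_epsilon)
      hence "ln (F z0) \<le> 1 / (2 * pi) * J" by (simp add: field_simps)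
      thus ?thesis by (simp add: elog_def J_def)
    qed (simp add: elog_def)
  qed
  thus "subharmonic_on {w. p + (\<chi> j. w * b $ j) \<in> {z. \<forall>j. \<alpha> $ j < 0 \<longrightarrow> z $ j \<noteq> 0}}
          (\<lambda>w. elog (zabs \<alpha> (p + (\<chi> j. w * b $ j))))"
    by (simp add: l_def F_def G_def)
qed

section \<open>Smoothness of the extremal function\<close>

lemma C2_on_const: "C2_on U (\<lambda>x. c)"
  unfolding C2_on_def
  by (intro exI[of _ "\<lambda>x h. 0"] exI[of _ "\<lambda>x h k. 0"]) auto

lemma C2_on_mult:
  fixes u w :: "'a::euclidean_space \<Rightarrow> real"
  assumes "C2_on U u" "C2_on U w"
  shows "C2_on U (\<lambda>x. u x * w x)"
proof -
  obtain D D2 where D: "\<And>x. x \<in> U \<Longrightarrow> (u has_derivative D x) (at x)"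
    "\<And>h x. x \<in> U \<Longrightarrow> ((\<lambda>y. D y h) has_derivative D2 x h) (at x)"
    "\<And>h k. continuous_on U (\<lambda>x. D2 x h k)"
    using assms(1) unfolding C2_on_def by metis
  obtain E E2 where E: "\<And>x. x \<in> U \<Longrightarrow> (w has_derivative E x) (at x)"
    "\<And>h x. x \<in> U \<Longrightarrow> ((\<lambda>y. E y h) has_derivative E2 x h) (at x)"
    "\<And>h k. continuous_on U (\<lambda>x. E2 x h k)"
    using assms(2) unfolding C2_on_def by metis
  have cont: "continuous_on U u" "continuous_on U w"
    "continuous_on U (\<lambda>x. D x h)" "continuous_on U (\<lambda>x. E x h)" for h
    using D E by (auto intro!: continuous_at_imp_continuous_on has_derivative_continuous)
  show ?thesis unfolding C2_on_def
  proof (rule exI[of _ "\<lambda>x h. u x * E x h + D x h * w x"],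
      rule exI[of _ "\<lambda>x h k. (u x * E2 x h k + D x k * E x h) + (D x h * E x k + D2 x h k * w x)"], intro conjI ballI allI)
    fix x h assume x: "x \<in> U"
    show "((\<lambda>x. u x * w x) has_derivative (\<lambda>h. u x * E x h + D x h * w x)) (at x)"
      by (rule has_derivative_mult[OF D(1)[OF x] E(1)[OF x]])
    show "((\<lambda>y. u y * E y h + D y h * w y) has_derivative
        (\<lambda>k. (u x * E2 x h k + D x k * E x h) + (D x h * E x k + D2 x h k * w x))) (at x)"
      by (intro has_derivative_add has_derivative_mult D E x)
  next
    fix h k
    show "continuous_on U (\<lambda>x. (u x * E2 x h k + D x k * E x h) + (D x h * E x k + D2 x h k * w x))"
      by (intro continuous_intros cont D E)
  qed
qed

lemma C2_on_prod:
  fixes u :: "'i \<Rightarrow> 'a::euclidean_space \<Rightarrow> real"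
  assumes "\<And>i. i \<in> I \<Longrightarrow> C2_on U (u i)"
  shows "C2_on U (\<lambda>x. \<Prod>i\<in>I. u i x)"
  using assms by (induction I rule: infinite_finite_induct) (auto intro: C2_on_const C2_on_mult)

lemma C2_on_compose_bounded_linear:
  fixes \<phi> :: "'b::euclidean_space \<Rightarrow> real" and l :: "'a::euclidean_space \<Rightarrow> 'b"
  assumes "C2_on V \<phi>" "bounded_linear l" "l ` U \<subseteq> V"
  shows "C2_on U (\<lambda>x. \<phi> (l x))"
proof -
  obtain D D2 where D: "\<And>x. x \<in> V \<Longrightarrow> (\<phi> has_derivative D x) (at x)"
    "\<And>h x. x \<in> V \<Longrightarrow> ((\<lambda>y. D y h) has_derivative D2 x h) (at x)"
    "\<And>h k. continuous_on V (\<lambda>x. D2 x h k)"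
    using assms(1) unfolding C2_on_def by metis
  have l: "(l has_derivative l) (at x)" for x by (rule bounded_linear_imp_has_derivative[OF assms(2)])
  show ?thesis unfolding C2_on_def
  proof (rule exI[of _ "\<lambda>x h. D (l x) (l h)"], rule exI[of _ "\<lambda>x h k. D2 (l x) (l h) (l k)"], intro conjI ballI allI)
    fix x h assume "x \<in> U"
    hence lx: "l x \<in> V" using assms(3) by blast
    show "((\<lambda>x. \<phi> (l x)) has_derivative (\<lambda>h. D (l x) (l h))) (at x)"
      by (rule has_derivative_compose[OF l D(1)[OF lx]])
    show "((\<lambda>y. D (l y) (l h)) has_derivative (\<lambda>k. D2 (l x) (l h) (l k))) (at x)"
      by (rule has_derivative_compose[OF l D(2)[OF lx]])
  next
    fix h k
    show "continuous_on U (\<lambda>x. D2 (l x) (l h) (l k))"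
      using assms(3) by (intro continuous_on_compose2[OF D(3)] linear_continuous_on assms(2))
  qed
qed

lemma has_derivative_norm_powr:
  fixes x :: "'a::euclidean_space"
  assumes "x \<noteq> 0"
  shows "((\<lambda>y. norm y powr s) has_derivative (\<lambda>k. s * norm x powr (s - 2) * (x \<bullet> k))) (at x)"
proof -
  have n: "(norm has_derivative (\<lambda>k. k \<bullet> sgn x)) (at x)"
    using has_derivative_norm[OF assms] by simp
  have "((\<lambda>t. t powr s) has_real_derivative s * norm x powr (s - 1)) (at (norm x))"
    using assms by (intro has_real_derivative_powr) simp
  hence p: "((\<lambda>t. t powr s) has_derivative (\<lambda>t. s * norm x powr (s - 1) * t)) (at (norm x))"
    by (simp add: has_field_derivative_def)
  have "s * norm x powr (s - 1) * (k \<bullet> sgn x) = s * norm x powr (s - 2) * (x \<bullet> k)" for k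
  proof -
    have "norm x powr (s - 1) = norm x powr (s - 2) * norm x"
      using assms powr_add[of "norm x" "s - 2" 1] by simp
    thus ?thesis using assms by (simp add: sgn_div_norm inner_commute)
  qed
  with has_derivative_compose[OF n p] show ?thesis by simp
qed

lemma tendsto_norm_powr_at_0:
  assumes "s > 0"
  shows "((\<lambda>y::'a::real_normed_vector. norm y powr s * c) \<longlongrightarrow> 0) (at 0)"
proof -
  have "((\<lambda>y::'a. norm y powr s) \<longlongrightarrow> norm (0::'a) powr s) (at 0)"
    using assms by (intro tendsto_powr' tendsto_intros) auto
  thus ?thesis by (auto intro!: tendsto_mult_left_zero)
qed

lemma has_derivative_zero_if_norm_le_powr:
  fixes \<phi> :: "'a::euclidean_space \<Rightarrow> real"
  assumes "\<And>y. \<bar>\<phi> y\<bar> \<le> C * norm y powr s" "s > 1"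
  shows "(\<phi> has_derivative (\<lambda>_. 0)) (at 0)"
proof -
  have \<phi>0: "\<phi> 0 = 0" using assms(1)[of 0] by simp
  have "((\<lambda>y. norm (\<phi> y) / norm y) \<longlongrightarrow> 0) (at 0)"
  proof (rule Lim_null_comparison[OF _ tendsto_norm_powr_at_0[of "s - 1" C]])
    show "\<forall>\<^sub>F y in at 0. norm (norm (\<phi> y) / norm y) \<le> norm y powr (s - 1) * C"
      unfolding eventually_at_filter
    proof (intro always_eventually allI impI)
      fix y :: 'a assume "y \<noteq> 0"
      hence "norm y powr s = norm y powr (s - 1) * norm y" using powr_add[of "norm y" "s - 1" 1] by simp
      thus "norm (norm (\<phi> y) / norm y) \<le> norm y powr (s - 1) * C"
        using assms(1)[of y] \<open>y \<noteq> 0\<close> by (simp add: divide_le_eq mult_ac)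
    qed
  qed (use assms in auto)
  thus ?thesis using \<phi>0 by (simp add: has_derivative_at)
qed

text \<open>At 0 the first derivative is \<open>O(norm y powr (e - 1))\<close> and the second
  \<open>O(norm y powr (e - 2))\<close>, so \<open>e > 2\<close> makes the first differentiable with
  derivative 0 and the second continuous.\<close>

lemma C2_on_norm_powr:
  fixes U :: "'a::euclidean_space set"
  assumes "0 \<notin> U \<or> e > 2"
  shows "C2_on U (\<lambda>x. norm x powr e)"
proof -
  txt \<open>These formulas are also valid at \<open>x = 0\<close> if \<open>e > 2\<close>, since \<open>0 powr s = 0\<close> for every \<open>s\<close>.\<close>
  define D where "D = (\<lambda>x h::'a. e * norm x powr (e - 2) * (x \<bullet> h))"
  define D2 where "D2 = (\<lambda>x h k::'a. e * ((e - 2) * norm x powr (e - 4) * (x \<bullet> k) * (x \<bullet> h) + norm x powr (e - 2) * (k \<bullet> h)))"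
  have pow4: "norm x powr (e - 4) * (norm x * norm x) = norm x powr (e - 2)" for x :: 'a
    using powr_add[of "norm x" "e - 4" 2] by (cases "x = 0") (auto simp: power2_eq_square)
  have pow2: "norm x powr (e - 2) * norm x = norm x powr (e - 1)" for x :: 'a
    using powr_add[of "norm x" "e - 2" 1] by (cases "x = 0") auto
  have D1: "((\<lambda>x. norm x powr e) has_derivative D x) (at x)" if "x \<in> U" for x
  proof (cases "x = 0")
    case True
    hence "e > 2" using assms that by auto
    hence "((\<lambda>x::'a. norm x powr e) has_derivative (\<lambda>_. 0)) (at 0)"
      by (intro has_derivative_zero_if_norm_le_powr[where C = 1 and s = e]) auto
    thus ?thesis using True by (simp add: D_def)
  next
    case False
    thus ?thesis using has_derivative_norm_powr[of x e] by (simp add: D_def)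
  qed
  have DD: "((\<lambda>y. D y h) has_derivative D2 x h) (at x)" if "x \<in> U" for x h
  proof (cases "x = 0")
    case True
    hence e: "e > 2" using assms that by auto
    have "\<bar>D y h\<bar> \<le> (e * norm h) * norm y powr (e - 1)" for y
    proof -
      have "\<bar>D y h\<bar> = e * norm y powr (e - 2) * \<bar>y \<bullet> h\<bar>" using e by (simp add: D_def abs_mult)
      also have "\<dots> \<le> e * norm y powr (e - 2) * (norm y * norm h)"
        using e by (intro mult_left_mono Cauchy_Schwarz_ineq2) auto
      also have "\<dots> = (e * norm h) * norm y powr (e - 1)" by (simp add: pow2[symmetric])
      finally show ?thesis .
    qed
    hence "((\<lambda>y. D y h) has_derivative (\<lambda>_. 0)) (at 0)"
      using e by (intro has_derivative_zero_if_norm_le_powr[where s = "e - 1"]) auto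
    moreover have "D2 0 h = (\<lambda>_. 0)" by (auto simp: D2_def)
    ultimately show ?thesis using True by simp
  next
    case False
    have "((\<lambda>y. e * (norm y powr (e - 2) * (y \<bullet> h))) has_derivative
       (\<lambda>k. e * (norm x powr (e - 2) * (k \<bullet> h) + (e - 2) * norm x powr (e - 2 - 2) * (x \<bullet> k) * (x \<bullet> h)))) (at x)"
      by (intro has_derivative_mult_right has_derivative_mult has_derivative_norm_powr False
          has_derivative_inner_left has_derivative_ident)
    thus ?thesis by (simp add: D_def D2_def mult.assoc add.commute)
  qed
  have DC: "continuous_on U (\<lambda>x. D2 x h k)" for h k
  proof (rule continuous_at_imp_continuous_on, rule ballI)
    fix x assume "x \<in> U"
    show "isCont (\<lambda>x. D2 x h k) x"
    proof (cases "x = 0")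
      case False
      thus ?thesis unfolding D2_def by (intro continuous_intros) auto
    next
      case True
      hence e: "e > 2" using assms \<open>x \<in> U\<close> by auto
      have "((\<lambda>y. D2 y h k) \<longlongrightarrow> 0) (at 0)"
      proof (rule Lim_null_comparison[OF always_eventually tendsto_norm_powr_at_0], rule allI)
        fix y :: 'a
        have a: "\<bar>norm y powr (e - 4) * (y \<bullet> k) * (y \<bullet> h)\<bar> \<le> norm y powr (e - 2) * (norm h * norm k)"
        proof -
          have "\<bar>norm y powr (e - 4) * (y \<bullet> k) * (y \<bullet> h)\<bar> = norm y powr (e - 4) * (\<bar>y \<bullet> k\<bar> * \<bar>y \<bullet> h\<bar>)"
            by (simp add: abs_mult)
          also have "\<dots> \<le> norm y powr (e - 4) * ((norm y * norm k) * (norm y * norm h))"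
            by (intro mult_left_mono mult_mono Cauchy_Schwarz_ineq2) auto
          also have "\<dots> = norm y powr (e - 2) * (norm h * norm k)" by (simp add: pow4[symmetric])
          finally show ?thesis .
        qed
        have b: "\<bar>norm y powr (e - 2) * (k \<bullet> h)\<bar> \<le> norm y powr (e - 2) * (norm h * norm k)"
          using mult_left_mono[OF Cauchy_Schwarz_ineq2[of k h], of "norm y powr (e - 2)"] by (simp add: abs_mult mult_ac)
        have "norm (D2 y h k) = e * \<bar>(e - 2) * (norm y powr (e - 4) * (y \<bullet> k) * (y \<bullet> h)) + norm y powr (e - 2) * (k \<bullet> h)\<bar>"
          using e by (simp add: D2_def abs_mult mult.assoc)
        also have "\<dots> \<le> e * ((e - 2) * \<bar>norm y powr (e - 4) * (y \<bullet> k) * (y \<bullet> h)\<bar> + \<bar>norm y powr (e - 2) * (k \<bullet> h)\<bar>)"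
          using e by (intro mult_left_mono order_trans[OF abs_triangle_ineq]) (auto simp: abs_mult)
        also have "\<dots> \<le> e * ((e - 2) * (norm y powr (e - 2) * (norm h * norm k)) + norm y powr (e - 2) * (norm h * norm k))"
          using e a b by (intro mult_left_mono add_mono) auto
        also have "\<dots> = norm y powr (e - 2) * (e * (e - 1) * (norm h * norm k))" by (simp add: algebra_simps)
        finally show "norm (D2 y h k) \<le> norm y powr (e - 2) * (e * (e - 1) * (norm h * norm k))" .
      qed (use e in auto)
      moreover have "D2 0 h k = 0" by (simp add: D2_def)
      ultimately show ?thesis using True by (simp add: isCont_def)
    qed
  qed
  show ?thesis unfolding C2_on_def using D1 DD DC by blast
qed

text \<open>Exponent 2 at the origin is a separate case: as \<open>0 powr 0 = 0\<close>, the second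
  derivative formula of \<open>C2_on_norm_powr\<close> would wrongly give 0 there. The function is
  the quadratic form \<open>x \<bullet> x\<close>.\<close>

lemma C2_on_norm_powr_2: "C2_on U (\<lambda>x::'a::euclidean_space. norm x powr 2)"
  unfolding C2_on_def
proof (rule exI[of _ "\<lambda>x h. x \<bullet> h + h \<bullet> x"], rule exI[of _ "\<lambda>x h k. k \<bullet> h + h \<bullet> k"], intro conjI ballI allI)
  fix x h :: 'a
  have "(\<lambda>x::'a. norm x powr 2) = (\<lambda>x. x \<bullet> x)"
    by (auto simp: power2_norm_eq_inner)
  thus "((\<lambda>x. norm x powr 2) has_derivative (\<lambda>h. x \<bullet> h + h \<bullet> x)) (at x)"
    using has_derivative_inner[OF has_derivative_ident has_derivative_ident] by simp
  show "((\<lambda>y. y \<bullet> h + h \<bullet> y) has_derivative (\<lambda>k. k \<bullet> h + h \<bullet> k)) (at x)"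
    by (intro has_derivative_add has_derivative_inner_left has_derivative_inner_right has_derivative_ident)
qed auto

text \<open>Each factor is a norm power composed with a coordinate projection; 0 lies in the image
  of \<open>U\<close> only if the exponent is 0 or at least 2.\<close>

lemma C2_on_zabs:
  assumes "\<And>j z. z \<in> U \<Longrightarrow> z $ j = 0 \<Longrightarrow> \<alpha> $ j = 0 \<or> \<alpha> $ j \<ge> 2"
  shows "C2_on U (zabs \<alpha>)"
proof -
  have "C2_on U (\<lambda>z. mpow (norm (z $ j)) (\<alpha> $ j))" for j
  proof (cases "\<alpha> $ j = 0")
    case False
    have "C2_on ((\<lambda>z. z $ j) ` U) (\<lambda>w. norm w powr (\<alpha> $ j))"
    proof (cases "\<alpha> $ j = 2")
      case True
      thus ?thesis by (simp add: C2_on_norm_powr_2 del: powr_numeral)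
    next
      case neq: False
      show ?thesis using False neq assms[of _ j] by (intro C2_on_norm_powr) force
    qed
    from C2_on_compose_bounded_linear[OF this bounded_linear_vec_nth order_refl] False show ?thesis
      by (simp add: mpow_def)
  qed (simp add: C2_on_const)
  thus ?thesis unfolding zabs_def by (intro C2_on_prod)
qed

section \<open>The extremal function as a competitor, and the resulting formula\<close>

lemma zabs_powr:
  assumes "c \<noteq> 0"
  shows "zabs \<alpha> z powr c = zabs (c *\<^sub>R \<alpha>) z"
  unfolding zabs_def prod_powr_distrib using assms
  by (intro prod.cong) (auto simp: mpow_def powr_powr mult.commute)

lemma zabs_powr_in_sibony_class:
  fixes \<alpha> :: "real^'n" and a :: "complex^'n"
  assumes a: "a \<in> Dalpha \<alpha>" and \<mu>: "\<mu> > 0" "\<And>j. \<alpha> $ j > 0 \<Longrightarrow> a $ j = 0 \<Longrightarrow> \<mu> \<le> \<alpha> $ j"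
    and k: "\<alpha> $ k > 0" "a $ k = 0"
  shows "(\<lambda>z. zabs \<alpha> z powr (2 / \<mu>)) \<in> sibony_class (Dalpha \<alpha>) a"
proof -
  define \<beta> where "\<beta> = (2 / \<mu>) *\<^sub>R \<alpha>"
  have eq: "(\<lambda>z. zabs \<alpha> z powr (2 / \<mu>)) = zabs \<beta>"
    using \<mu> by (auto simp: \<beta>_def zabs_powr)
  have sign: "\<beta> $ j < 0 \<longleftrightarrow> \<alpha> $ j < 0" "\<beta> $ j = 0 \<longleftrightarrow> \<alpha> $ j = 0" for j
    using \<mu> by (auto simp: \<beta>_def mult_less_0_iff divide_less_0_iff)
  have "zabs \<beta> z < 1" if "z \<in> Dalpha \<alpha>" for z
  proof -
    have "zabs \<alpha> z powr (2 / \<mu>) < 1 powr (2 / \<mu>)"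
      using that \<mu> by (intro powr_less_mono2) (auto simp: Dalpha_def)
    thus ?thesis using eq by (simp add: fun_eq_iff)
  qed
  moreover have "psh_on (Dalpha \<alpha>) (\<lambda>z. elog (zabs \<beta> z))"
    by (rule psh_on_subset[OF psh_on_elog_zabs]) (auto simp: Dalpha_def sign)
  moreover have "zabs \<beta> a = 0"
    unfolding zabs_eq_0_iff using k sign by (intro exI[of _ k]) auto
  moreover have "\<exists>U. open U \<and> a \<in> U \<and> U \<subseteq> Dalpha \<alpha> \<and> C2_on U (zabs \<beta>)"
  proof (intro exI conjI)
    \<comment> \<open>Coordinates that are nonzero at \<open>a\<close> stay nonzero on
      \<open>U\<close>; those that may vanish there have exponent 0 in \<open>\<beta>\<close>, or at
      least 2 because of \<open>\<mu> \<le> \<alpha> $ j\<close>.\<close>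
    define U where "U = Dalpha \<alpha> \<inter> (\<Inter>j\<in>{j. a $ j \<noteq> 0}. {z. z $ j \<noteq> 0})"
    have "open {z::complex^'n. z $ j \<noteq> 0}" for j
      by (intro open_Collect_neq continuous_intros)
    thus "open U" unfolding U_def by (intro open_Int open_Dalpha open_INT) auto
    show "a \<in> U" "U \<subseteq> Dalpha \<alpha>" using a by (auto simp: U_def)
    show "C2_on U (zabs \<beta>)"
    proof (rule C2_on_zabs)
      fix j z assume "z \<in> U" "z $ j = 0"
      hence "a $ j = 0" by (auto simp: U_def)
      hence "\<not> \<alpha> $ j < 0" using a by (auto simp: Dalpha_def)
      hence "\<alpha> $ j = 0 \<or> \<mu> \<le> \<alpha> $ j" using \<mu>(2)[of j] \<open>a $ j = 0\<close> by linarith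
      thus "\<beta> $ j = 0 \<or> 2 \<le> \<beta> $ j" using \<mu>(1) by (auto simp: \<beta>_def field_simps)
    qed
  qed
  ultimately show ?thesis unfolding eq sibony_class_def by auto
qed

theorem theorem1:
  fixes \<alpha> :: "real^'n" and a :: "complex^'n"
  assumes "CARD('n) \<ge> 2"
    and "\<alpha> \<noteq> 0"
    and "a \<in> Dalpha \<alpha>"
    and "card {j. \<alpha> $ j > 0 \<and> a $ j = 0} \<ge> 2"
  shows "\<forall>z\<in>Dalpha \<alpha>. sibony (Dalpha \<alpha>) a z
           = zabs \<alpha> z powr (1 / Min {\<alpha> $ j | j. \<alpha> $ j > 0 \<and> a $ j = 0})"
proof
  fix z assume z: "z \<in> Dalpha \<alpha>"
  define S where "S = {\<alpha> $ j | j. \<alpha> $ j > 0 \<and> a $ j = 0}"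
  have "{j. \<alpha> $ j > 0 \<and> a $ j = 0} \<noteq> {}" using assms(4) by (metis card.empty not_numeral_le_zero)
  hence S: "finite S" "S \<noteq> {}" by (auto simp: S_def)
  obtain k where k: "\<alpha> $ k = Min S" "\<alpha> $ k > 0" "a $ k = 0" using Min_in[OF S] by (auto simp: S_def)
  have min: "\<alpha> $ k \<le> \<alpha> $ j" if "\<alpha> $ j > 0" "a $ j = 0" for j
    using S that unfolding k(1) by (intro Min_le) (auto simp: S_def)
  have sqrt: "sqrt (zabs \<alpha> z powr (2 / \<alpha> $ k)) = zabs \<alpha> z powr (1 / \<alpha> $ k)"
    by (simp add: powr_half_sqrt[symmetric] powr_powr)
  \<comment> \<open>The supremum is attained by the competitor
    \<open>zabs \<alpha> z powr (2 / \<alpha> $ k)\<close>, whose exponent is halved by the square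
    root in \<open>sibony\<close>.\<close>
  have "sibony (Dalpha \<alpha>) a z = zabs \<alpha> z powr (1 / \<alpha> $ k)"
    unfolding sibony_def
  proof (rule cSup_eq_maximum)
    show "zabs \<alpha> z powr (1 / \<alpha> $ k) \<in> {sqrt (u z) |u. u \<in> sibony_class (Dalpha \<alpha>) a}"
      using zabs_powr_in_sibony_class[OF assms(3) k(2) min k(2,3)] sqrt by force
    fix x assume "x \<in> {sqrt (u z) |u. u \<in> sibony_class (Dalpha \<alpha>) a}"
    then obtain u where u: "u \<in> sibony_class (Dalpha \<alpha>) a" "x = sqrt (u z)" by blast
    show "x \<le> zabs \<alpha> z powr (1 / \<alpha> $ k)"
      unfolding u(2) sqrt[symmetric] using sibony_class_Dalpha_le[OF u(1) assms(3) k(2,3) z] by simp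
  qed
  thus "sibony (Dalpha \<alpha>) a z = zabs \<alpha> z powr (1 / Min {\<alpha> $ j | j. \<alpha> $ j > 0 \<and> a $ j = 0})"
    using k(1) by (simp add: S_def)
qed

end
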